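(* Let $G$ be an ordered graph. Then $\overline L_G(q)\in\mathfrak{m}\mathsf{Sym}[q]$ if and only if $G$ is a cluster graph, that is, a disjoint union of complete graphs.
   Context: An ordered graph is a finite simple undirected graph $G$ with a total order $<$ on its vertex set $V(G)$. Let $\mathbb{K}$ be an integral domain containing $\mathbb{Z}$, let $q$ be a formal parameter, and let $x_1,x_2,\dots$ be commuting variables. $\mathbb{P}=\{1,2,3,\dots\}$ and $\mathsf{Set}(\mathbb{P})$ is the set of finite nonempty subsets of $\mathbb{P}$. A proper set-valued coloring of $G$ is a map $\kappa:V(G)\to\mathsf{Set}(\mathbb{P})$ with $\kappa(u)\cap\kappa(v)=\varnothing$ for all $\{u,v\}\in E(G)$; put $x^\kappa=\prod_{v\in V(G)}\prod_{j\in\kappa(v)}x_j$. For a map $c:V(G)\to\mathbb{P}$, $\mathrm{asc}_G(c)$ is the number of edges $\{u,v\}\in E(G)$ with $u<v$ and $c(u)<c(v)$. Define $$\overline L_G(q)=\sum_\kappa q^{\mathrm{asc}_G(\max\circ\kappa)}x^\kappa,$$ summed over all proper set-valued colorings $\kappa$ of $G$, where $(\max\circ\kappa)(v)=\max(\kappa(v))$. This is a polynomial in $q$ whose coefficients are quasisymmetric power series. $\mathfrak{m}\mathsf{Sym}$ denotes the ring of symmetric power series in $\mathbb{K}[[x_1,x_2,\dots]]$ of possibly unbounded degree, and $\mathfrak{m}\mathsf{Sym}[q]$ the polynomials in $q$ over it. *)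

theory Defs
  imports
    "HOL-Library.Poly_Mapping"
    "HOL-Library.FuncSet"
    "HOL-Library.Disjoint_Sets"
    "HOL-Computational_Algebra.Polynomial"
begin

section \<open>The positive integers\<close>

typedef pos = "{n::nat. 0 < n}"
  morphisms nat_of_pos pos_of_nat
  by auto

setup_lifting type_definition_pos

instantiation pos :: linorder
begin
lift_definition less_eq_pos :: "pos \<Rightarrow> pos \<Rightarrow> bool" is "(\<le>)" .
lift_definition less_pos :: "pos \<Rightarrow> pos \<Rightarrow> bool" is "(<)" .
instance by standard (transfer; auto)+
end


section \<open>Power series in commuting variables indexed by the positive integers\<close>

text \<open>A monomial is a finitely supported exponent vector. A power series is an arbitrary
  function from monomials to coefficients, so its degree may be unbounded.\<close>

type_synonym mon = "pos \<Rightarrow>\<^sub>0 nat"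

typedef 'k mps = "UNIV :: (mon \<Rightarrow> 'k) set"
  morphisms mps_coeff Mps
  by auto

lemma mps_eqI: "(\<And>m. mps_coeff f m = mps_coeff g m) \<Longrightarrow> f = g"
  by (simp add: mps_coeff_inject[symmetric] fun_eq_iff)

lemma mps_coeff_Mps [simp]: "mps_coeff (Mps f) = f"
  by (simp add: Mps_inverse)

lemma finite_mon_le:
  fixes m :: mon
  shows "finite {a :: mon. \<forall>i. Poly_Mapping.lookup a i \<le> Poly_Mapping.lookup m i}"
proof -
  define B where "B = {f. \<forall>i. (i \<in> Poly_Mapping.keys m \<longrightarrow> f i \<in> {..\<Sum>j\<in>Poly_Mapping.keys m. Poly_Mapping.lookup m j})
    \<and> (i \<notin> Poly_Mapping.keys m \<longrightarrow> f i = (0::nat))}"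
  have finB: "finite B"
    unfolding B_def by (rule finite_set_of_finite_funs) auto
  have *: "Poly_Mapping.lookup a \<in> B" if "\<forall>i. Poly_Mapping.lookup a i \<le> Poly_Mapping.lookup m i" for a :: mon
    unfolding B_def
  proof (intro CollectI allI conjI impI)
    fix i assume "i \<in> Poly_Mapping.keys m"
    hence "Poly_Mapping.lookup m i \<le> (\<Sum>j\<in>Poly_Mapping.keys m. Poly_Mapping.lookup m j)"
      by (intro member_le_sum) auto
    thus "Poly_Mapping.lookup a i \<in> {..\<Sum>j\<in>Poly_Mapping.keys m. Poly_Mapping.lookup m j}"
      using that by (meson atMost_iff order_trans)
  next
    fix i assume "i \<notin> Poly_Mapping.keys m"
    thus "Poly_Mapping.lookup a i = 0" using that[rule_format, of i] by (simp add: in_keys_iff)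
  qed
  have "finite (Poly_Mapping.lookup ` {a :: mon. \<forall>i. Poly_Mapping.lookup a i \<le> Poly_Mapping.lookup m i})"
    by (rule finite_subset[OF _ finB]) (use * in auto)
  thus ?thesis
    by (rule finite_imageD) (auto simp: inj_on_def lookup_inject)
qed

lemma finite_mon_splits [simp]: "finite {(a, b). a + b = (m :: mon)}"
  by (rule finite_subset[OF _ finite_cartesian_product[OF finite_mon_le[of m] finite_mon_le[of m]]])
     (auto simp: lookup_add)

lemma finite_mon_splits' [simp]: "finite {p. fst p + snd p = (m :: mon)}"
  using finite_mon_splits[of m] by (simp add: case_prod_unfold)

instantiation mps :: (comm_ring_1) comm_ring_1
begin

definition "0 = Mps (\<lambda>_. 0)"
definition "1 = Mps (\<lambda>m. if m = 0 then 1 else 0)"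
definition "f + g = Mps (\<lambda>m. mps_coeff f m + mps_coeff g m)"
definition "f - g = Mps (\<lambda>m. mps_coeff f m - mps_coeff g m)"
definition "- f = Mps (\<lambda>m. - mps_coeff f m)"
definition "f * g = Mps (\<lambda>m. \<Sum>(a, b) | a + b = m. mps_coeff f a * mps_coeff g b)"

instance
proof
  fix f g h :: "'a mps"
  let ?f = "mps_coeff f" and ?g = "mps_coeff g" and ?h = "mps_coeff h"
  show comm: "f * g = g * f" for f g :: "'a mps"
  proof (rule mps_eqI)
    fix m
    show "mps_coeff (f * g) m = mps_coeff (g * f) m"
      unfolding times_mps_def mps_coeff_Mps
      by (rule sum.reindex_bij_witness[of _ prod.swap prod.swap])
         (auto simp: add.commute mult.commute)
  qed
  show "f * g * h = f * (g * h)"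
  proof (rule mps_eqI)
    fix m
    have "mps_coeff (f * g * h) m =
        (\<Sum>(x, c) | x + c = m. \<Sum>(a, b) | a + b = x. ?f a * ?g b * ?h c)"
      by (simp add: times_mps_def sum_distrib_right case_prod_unfold)
    also have "\<dots> = (\<Sum>(p, q)\<in>Sigma {(x, c). x + c = m} (\<lambda>p. {(a, b). a + b = fst p}).
        ?f (fst q) * ?g (snd q) * ?h (snd p))"
      by (subst sum.Sigma[symmetric]) (auto simp: case_prod_unfold)
    also have "\<dots> = (\<Sum>(p, q)\<in>Sigma {(a, y). a + y = m} (\<lambda>p. {(b, c). b + c = snd p}).
        ?f (fst p) * (?g (fst q) * ?h (snd q)))"
      by (rule sum.reindex_bij_witness[of _
            "\<lambda>((a, y), (b, c)). ((a + b, c), (a, b))" "\<lambda>((x, c), (a, b)). ((a, b + c), (b, c))"])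
         (auto simp: add.assoc mult.assoc)
    also have "\<dots> = (\<Sum>(a, y) | a + y = m. \<Sum>(b, c) | b + c = y. ?f a * (?g b * ?h c))"
      by (subst sum.Sigma[symmetric]) (auto simp: case_prod_unfold)
    also have "\<dots> = mps_coeff (f * (g * h)) m"
      by (simp add: times_mps_def sum_distrib_left case_prod_unfold)
    finally show "mps_coeff (f * g * h) m = mps_coeff (f * (g * h)) m" .
  qed
  show "1 * f = f"
  proof (rule mps_eqI)
    fix m
    have "mps_coeff (1 * f) m = (\<Sum>p | fst p + snd p = m. if p = (0, m) then ?f m else 0)"
      unfolding times_mps_def one_mps_def mps_coeff_Mps case_prod_unfold
      by (rule sum.cong) (auto simp: prod_eq_iff)
    also have "\<dots> = ?f m"
      using finite_mon_splits[of m] by (simp add: case_prod_unfold)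
    finally show "mps_coeff (1 * f) m = ?f m" .
  qed
  show "(f + g) * h = f * h + g * h"
    by (rule mps_eqI)
       (simp add: times_mps_def plus_mps_def distrib_right sum.distrib case_prod_unfold)
  have "mps_coeff (0 :: 'a mps) 0 \<noteq> mps_coeff 1 0"
    by (simp add: zero_mps_def one_mps_def)
  thus "(0 :: 'a mps) \<noteq> 1" by metis
qed (auto simp: zero_mps_def plus_mps_def minus_mps_def uminus_mps_def algebra_simps
      intro!: mps_eqI)

end

definition mps_var :: "pos \<Rightarrow> 'k::comm_ring_1 mps" where
  "mps_var j = Mps (\<lambda>m. if m = Poly_Mapping.single j 1 then 1 else 0)"

text \<open>For a bijection \<open>\<sigma>\<close>, \<open>Poly_Mapping.map_key \<sigma> m\<close> is the exponent vector
  \<open>Poly_Mapping.lookup m \<circ> \<sigma>\<close>, that is, \<open>m\<close> with its variables permuted.\<close>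

definition mSym :: "'k::comm_ring_1 mps set" where
  "mSym = {f. \<forall>\<sigma>. bij \<sigma> \<longrightarrow>
     (\<forall>m. mps_coeff f (Poly_Mapping.map_key \<sigma> m) = mps_coeff f m)}"

definition mSym_q :: "'k::comm_ring_1 mps poly set" where
  "mSym_q = {p. \<forall>i. coeff p i \<in> mSym}"

text \<open>Sum of a possibly infinite family of polynomials in \<open>q\<close>, computed coefficientwise; it is
  meaningful when each monomial of each power of \<open>q\<close> occurs in only finitely many members of the
  family, and the degrees in \<open>q\<close> are bounded.\<close>

definition formal_sum :: "('c \<Rightarrow> 'k::comm_ring_1 mps poly) \<Rightarrow> 'c set \<Rightarrow> 'k mps poly" where
  "formal_sum F A = Abs_poly (\<lambda>i. Mps (\<lambda>m.
     \<Sum>x | x \<in> A \<and> mps_coeff (coeff (F x) i) m \<noteq> 0. mps_coeff (coeff (F x) i) m))"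


section \<open>Ordered graphs and set-valued colorings\<close>

text \<open>\<open>(u, v) \<in> r\<close> means \<open>u \<le> v\<close> in the order on the vertices.\<close>

definition ordered_graph :: "'v set \<Rightarrow> 'v set set \<Rightarrow> ('v \<times> 'v) set \<Rightarrow> bool" where
  "ordered_graph V E r \<longleftrightarrow>
     finite V \<and> (\<forall>e\<in>E. e \<subseteq> V \<and> card e = 2) \<and> linear_order_on V r"

definition cluster_graph :: "'v set \<Rightarrow> 'v set set \<Rightarrow> bool" where
  "cluster_graph V E \<longleftrightarrow>
     (\<exists>P. partition_on V P \<and> E = {{u, v} | u v. u \<noteq> v \<and> (\<exists>B\<in>P. u \<in> B \<and> v \<in> B)})"

text \<open>Colorings are extensional, so that each map on \<open>V\<close> is counted once.\<close>

definition proper_colorings :: "'v set \<Rightarrow> 'v set set \<Rightarrow> ('v \<Rightarrow> pos set) set" where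
  "proper_colorings V E = {\<kappa> \<in> V \<rightarrow>\<^sub>E {S. finite S \<and> S \<noteq> {}}.
     \<forall>u v. {u, v} \<in> E \<longrightarrow> \<kappa> u \<inter> \<kappa> v = {}}"

definition x_pow :: "'v set \<Rightarrow> ('v \<Rightarrow> pos set) \<Rightarrow> 'k::comm_ring_1 mps" where
  "x_pow V \<kappa> = (\<Prod>v\<in>V. \<Prod>j\<in>\<kappa> v. mps_var j)"

definition asc :: "'v set set \<Rightarrow> ('v \<times> 'v) set \<Rightarrow> ('v \<Rightarrow> pos) \<Rightarrow> nat" where
  "asc E r c = card {e \<in> E. \<exists>u v. e = {u, v} \<and> (u, v) \<in> r \<and> u \<noteq> v \<and> c u < c v}"

definition Lbar :: "'v set \<Rightarrow> 'v set set \<Rightarrow> ('v \<times> 'v) set \<Rightarrow> 'k::comm_ring_1 mps poly" where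
  "Lbar V E r =
     formal_sum (\<lambda>\<kappa>. monom (x_pow V \<kappa>) (asc E r (Max \<circ> \<kappa>))) (proper_colorings V E)"


section \<open>The sum defining \<open>Lbar\<close> is well-defined\<close>

definition mon_series :: "mon \<Rightarrow> 'k::comm_ring_1 mps" where
  "mon_series a = Mps (\<lambda>m. if m = a then 1 else 0)"

lemma mps_coeff_mon_series: "mps_coeff (mon_series a) m = (if m = a then 1 else 0)"
  by (simp add: mon_series_def)

lemma mon_series_0: "mon_series 0 = 1"
  by (simp add: mon_series_def one_mps_def)

lemma mon_series_mult: "mon_series a * mon_series b = mon_series (a + b)"
proof (rule mps_eqI)
  fix m
  have "mps_coeff (mon_series a * mon_series b :: 'a mps) m
      = (\<Sum>p | fst p + snd p = m. if p = (a, b) then 1 else 0)"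
    unfolding times_mps_def mon_series_def mps_coeff_Mps case_prod_unfold
    by (rule sum.cong) (auto simp: prod_eq_iff)
  also have "\<dots> = mps_coeff (mon_series (a + b)) m"
    using finite_mon_splits[of m] by (auto simp: case_prod_unfold mon_series_def)
  finally show "mps_coeff (mon_series a * mon_series b :: 'a mps) m
      = mps_coeff (mon_series (a + b)) m" .
qed

lemma mon_series_sum: "mon_series (sum f A) = (\<Prod>x\<in>A. mon_series (f x))"
  by (induction A rule: infinite_finite_induct)
     (simp_all add: mon_series_0 mon_series_mult[symmetric])

lemma x_pow_eq: "x_pow V \<kappa> = mon_series (\<Sum>v\<in>V. \<Sum>j\<in>\<kappa> v. Poly_Mapping.single j 1)"
  by (simp add: x_pow_def mps_var_def mon_series_sum) (simp add: mon_series_def)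

lemma finite_colorings_of_mon:
  fixes m :: mon
  assumes "finite V"
  shows "finite {\<kappa> \<in> proper_colorings V E. mps_coeff (x_pow V \<kappa> :: 'k::comm_ring_1 mps) m \<noteq> 0}"
proof (rule finite_subset)
  show "finite (V \<rightarrow>\<^sub>E Pow (Poly_Mapping.keys m))"
    using assms by (intro finite_PiE) auto
  show "{\<kappa> \<in> proper_colorings V E. mps_coeff (x_pow V \<kappa> :: 'k mps) m \<noteq> 0}
      \<subseteq> (V \<rightarrow>\<^sub>E Pow (Poly_Mapping.keys m))"
  proof
    fix \<kappa> assume "\<kappa> \<in> {\<kappa> \<in> proper_colorings V E. mps_coeff (x_pow V \<kappa> :: 'k mps) m \<noteq> 0}"
    hence \<kappa>: "\<kappa> \<in> V \<rightarrow>\<^sub>E {S. finite S \<and> S \<noteq> {}}"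
      and m: "m = (\<Sum>v\<in>V. \<Sum>j\<in>\<kappa> v. Poly_Mapping.single j 1)"
      by (auto simp: proper_colorings_def x_pow_eq mps_coeff_mon_series split: if_splits)
    have "j \<in> Poly_Mapping.keys m" if v: "v \<in> V" and j: "j \<in> \<kappa> v" for v j
    proof -
      have "finite (\<kappa> v)" using \<kappa> v by (auto dest: PiE_mem)
      hence "Poly_Mapping.lookup (Poly_Mapping.single j 1) j
          \<le> (\<Sum>i\<in>\<kappa> v. Poly_Mapping.lookup (Poly_Mapping.single i (1::nat)) j)"
        using j by (intro member_le_sum[where f = "\<lambda>i. Poly_Mapping.lookup (Poly_Mapping.single i 1) j"]) auto
      also have "\<dots> \<le> (\<Sum>v\<in>V. \<Sum>i\<in>\<kappa> v. Poly_Mapping.lookup (Poly_Mapping.single i (1::nat)) j)"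
        using v assms
        by (intro member_le_sum[where f = "\<lambda>v. \<Sum>i\<in>\<kappa> v. Poly_Mapping.lookup (Poly_Mapping.single i 1) j"]) auto
      also have "\<dots> = Poly_Mapping.lookup m j"
        by (simp add: m lookup_sum)
      finally show ?thesis by (simp add: in_keys_iff)
    qed
    thus "\<kappa> \<in> V \<rightarrow>\<^sub>E Pow (Poly_Mapping.keys m)"
      using \<kappa> by (auto simp: PiE_iff)
  qed
qed

lemma asc_le_card: "finite E \<Longrightarrow> asc E r c \<le> card E"
  unfolding asc_def by (intro card_mono) auto

lemma coeff_Lbar:
  assumes "ordered_graph V E r"
  shows "mps_coeff (coeff (Lbar V E r :: 'k::comm_ring_1 mps poly) i) m =
    of_nat (card {\<kappa> \<in> proper_colorings V E. asc E r (Max \<circ> \<kappa>) = i \<and>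
      (\<Sum>v\<in>V. \<Sum>j\<in>\<kappa> v. Poly_Mapping.single j 1) = m})"
proof -
  define S :: "nat \<Rightarrow> mon \<Rightarrow> ('a \<Rightarrow> pos set) set" where
    "S i m = {\<kappa> \<in> proper_colorings V E. asc E r (Max \<circ> \<kappa>) = i \<and>
      (\<Sum>v\<in>V. \<Sum>j\<in>\<kappa> v. Poly_Mapping.single j 1) = m}" for i m
  have "finite E"
    using assms by (intro finite_subset[of E "Pow V"]) (auto simp: ordered_graph_def)
  have supp: "{\<kappa>. \<kappa> \<in> proper_colorings V E \<and>
      mps_coeff (coeff (monom (x_pow V \<kappa> :: 'k mps) (asc E r (Max \<circ> \<kappa>))) i) m \<noteq> 0} = S i m" for i m
    by (auto simp: S_def x_pow_eq mps_coeff_mon_series zero_mps_def)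
  have val: "(\<Sum>\<kappa>\<in>S i m. mps_coeff (coeff (monom (x_pow V \<kappa> :: 'k mps) (asc E r (Max \<circ> \<kappa>))) i) m)
      = of_nat (card (S i m))" for i m
    by (simp add: S_def x_pow_eq mps_coeff_mon_series)
  have S_empty: "S i m = {}" if "i > card E" for i m
    using that asc_le_card[OF \<open>finite E\<close>] by (auto simp: S_def not_less[symmetric])
  have "Lbar V E r = Abs_poly (\<lambda>i. Mps (\<lambda>m. of_nat (card (S i m)) :: 'k))"
    by (simp only: Lbar_def formal_sum_def supp val)
  moreover have "\<forall>\<^sub>\<infinity>i. Mps (\<lambda>m. of_nat (card (S i m)) :: 'k) = 0"
    unfolding MOST_nat by (intro exI[of _ "card E"]) (auto simp: S_empty zero_mps_def)
  ultimately show ?thesis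
    by (simp add: Abs_poly_inverse S_def)
qed

end

theory Submission
  imports Defs "HOL-Combinatorics.Transposition"
begin

text \<open>The coefficient of \<open>q^i x^m\<close> in \<open>Lbar\<close> is a number of colorings, so over a ring of characteristic zero
symmetry says that the number of proper set-valued colorings with \<open>i\<close> ascents in which each color
\<open>j\<close> is used \<open>m j\<close> times does not change when the exponents \<open>m\<close> are permuted.

If the graph is a cluster graph, a permutation \<open>\<tau>\<close> of the colors acts on colorings without changing
the ascents: replace each color set by its image under \<open>\<tau>\<close>, and then redistribute the image sets inside
each clique so that their maxima come in the same relative order as before. The redistribution is
unique, hence \<open>inv \<tau>\<close> undoes the operation (\<open>rename_inverse\<close>), and the two counts agree.

For the converse only the top power of \<open>q\<close>, where every edge is an ascent, is needed. Orient each edge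
from its smaller to its larger endpoint, so that the maxima of a counted coloring increase along arcs.

First, a stable set \<open>S\<close> is never larger than the set of sinks (\<open>stable_le_sinks\<close>): give the vertices
distinct increasing colors and add to those in \<open>S\<close> one extra color below all others. This
is where sets with two elements matter. Moving the extra color to the top by symmetry produces \<open>card S\<close> vertices that
carry the largest color, and these are sinks. The same bound follows for
stable sets inside an up-closed set \<open>C\<close> and the sinks in \<open>C\<close>, because the sinks outside \<open>C\<close> can be added.

Second, let \<open>C\<close> be an up-closed set of least cardinality that does not induce a cluster graph. Removing a
source leaves a cluster graph, and the bound on stable sets then forces \<open>C\<close> to have just one source
(\<open>source_unique\<close>). So in a coloring whose maxima increase along arcs, one vertex of \<open>C\<close> lies strictly below
all others, whereas at least two vertices of \<open>C\<close> are sinks.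

Third, color \<open>V - C\<close> with distinct low colors, the sinks in \<open>C\<close> with one common topmost color and the rest
of \<open>C\<close> with distinct colors in between, and let \<open>\<sigma>\<close> exchange the color of the source of \<open>C\<close> with the
topmost one. A coloring with the permuted exponents has an up-closed set of \<open>card C\<close> vertices with high
colors, and the lowest high color occurs at least twice there. By the previous step
that set cannot be a minimal up-closed set of the bad kind, so it induces a cluster graph, and
renaming colors on it gives a coloring with the original exponents. This injection misses the coloring that
was constructed, whose high vertices form \<open>C\<close>, so the two counts differ (\<open>card_colorings_with_less\<close>).\<close>

section \<open>Order-preserving permutations\<close>

definition position :: "('a \<Rightarrow> 'b::linorder) \<Rightarrow> 'a set \<Rightarrow> 'a \<Rightarrow> nat" where
  "position a K v = card {w \<in> K. a w < a v}"

text \<open>For injective \<open>a\<close> and \<open>b\<close> this is the order isomorphism from \<open>K\<close> ordered by \<open>a\<close> to \<open>K\<close> ordered by \<open>b\<close>.\<close>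

definition align :: "('a \<Rightarrow> 'b::linorder) \<Rightarrow> ('a \<Rightarrow> 'b) \<Rightarrow> 'a set \<Rightarrow> 'a \<Rightarrow> 'a" where
  "align a b K v = (THE w. w \<in> K \<and> position b K w = position a K v)"

lemma position_less_iff:
  assumes "finite K" "u \<in> K" "v \<in> K"
  shows "position a K u < position a K v \<longleftrightarrow> a u < a v"
proof -
  have less: "position a K u < position a K v" if "a u < a v" "u \<in> K" for u v
    unfolding position_def using that assms(1) by (intro psubset_card_mono) auto
  have le: "position a K v \<le> position a K u" if "a v \<le> a u" for u v
    unfolding position_def using that assms(1) by (intro card_mono) auto
  show ?thesis using less[of u v] le[of v u] assms by (meson not_less)
qed

lemma bij_betw_position:
  assumes "finite K" "inj_on a K"
  shows "bij_betw (position a K) K {..<card K}"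
proof -
  have inj: "inj_on (position a K) K"
  proof (rule inj_onI)
    fix u v assume "u \<in> K" "v \<in> K" "position a K u = position a K v"
    then have "a u = a v"
      using position_less_iff[OF assms(1), of u v a] position_less_iff[OF assms(1), of v u a] by auto
    then show "u = v" using assms(2) \<open>u \<in> K\<close> \<open>v \<in> K\<close> by (auto dest: inj_onD)
  qed
  moreover have "position a K ` K \<subseteq> {..<card K}"
  proof
    fix x assume "x \<in> position a K ` K"
    then obtain v where "v \<in> K" "x = card {w \<in> K. a w < a v}" by (auto simp: position_def)
    moreover have "card {w \<in> K. a w < a v} < card K"
      using assms(1) \<open>v \<in> K\<close> by (intro psubset_card_mono) auto
    ultimately show "x \<in> {..<card K}" by simp
  qed
  ultimately show ?thesis
    by (simp add: bij_betw_def card_image card_subset_eq)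
qed

lemma align_position:
  assumes "finite K" "inj_on a K" "inj_on b K" "v \<in> K"
  shows "align a b K v \<in> K \<and> position b K (align a b K v) = position a K v"
proof -
  have "position a K v \<in> {..<card K}"
    using bij_betw_position[OF assms(1,2)] assms(4) by (auto simp: bij_betw_def)
  then obtain w where w: "w \<in> K" "position b K w = position a K v"
    using bij_betw_position[OF assms(1,3)] by (metis bij_betw_iff_bijections)
  have "inj_on (position b K) K"
    using bij_betw_position[OF assms(1,3)] by (auto simp: bij_betw_def)
  then have "\<exists>!w. w \<in> K \<and> position b K w = position a K v"
    using w by (metis inj_onD)
  then show ?thesis unfolding align_def by (rule theI')
qed

lemma align_less_iff:
  assumes "finite K" "inj_on a K" "inj_on b K" "u \<in> K" "v \<in> K"
  shows "b (align a b K u) < b (align a b K v) \<longleftrightarrow> a u < a v"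
  using align_position[OF assms(1-3)] position_less_iff[OF assms(1)] assms(4,5) by metis

lemma inj_on_align:
  assumes "finite K" "inj_on a K" "inj_on b K"
  shows "inj_on (align a b K) K"
proof (rule inj_onI)
  fix u v assume uv: "u \<in> K" "v \<in> K" "align a b K u = align a b K v"
  then have "a u = a v"
    using align_less_iff[OF assms, of u v] align_less_iff[OF assms, of v u] by auto
  then show "u = v" using assms(2) uv by (auto dest: inj_onD)
qed

text \<open>A finite chain has no order automorphism but the identity; this makes the
redistribution of color sets invertible.\<close>

lemma order_preserving_permutation_eq_id:
  fixes a :: "'a \<Rightarrow> 'b::linorder"
  assumes "finite K" "inj_on a K" "bij_betw p K K"
    and mono: "\<And>u v. u \<in> K \<Longrightarrow> v \<in> K \<Longrightarrow> a (p u) < a (p v) \<longleftrightarrow> a u < a v"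
    and "v \<in> K"
  shows "p v = v"
proof -
  have pK: "p u \<in> K" if "u \<in> K" for u using assms(3) that by (auto simp: bij_betw_def)
  have "{w \<in> K. a w < a (p v)} = p ` {u \<in> K. a u < a v}"
  proof (intro equalityI subsetI)
    fix w assume w: "w \<in> {w \<in> K. a w < a (p v)}"
    then obtain u where "u \<in> K" "w = p u" using assms(3) by (auto simp: bij_betw_def)
    then show "w \<in> p ` {u \<in> K. a u < a v}" using w mono \<open>v \<in> K\<close> by auto
  qed (use pK mono \<open>v \<in> K\<close> in auto)
  moreover have "inj_on p {u \<in> K. a u < a v}"
    using assms(3) by (auto simp: bij_betw_def inj_on_def)
  ultimately have "position a K (p v) = position a K v"
    unfolding position_def by (simp add: card_image)
  then show ?thesis
    using bij_betw_position[OF assms(1,2)] pK \<open>v \<in> K\<close> by (auto simp: bij_betw_def dest: inj_onD)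
qed


section \<open>Cluster graphs\<close>

text \<open>No three vertices of \<open>H\<close> induce a path. This local form of being a cluster graph is
inherited by subsets and is convenient for exhibiting an obstruction.\<close>

definition P3_free :: "'v set set \<Rightarrow> 'v set \<Rightarrow> bool" where
  "P3_free E H \<longleftrightarrow> (\<forall>u\<in>H. \<forall>v\<in>H. \<forall>w\<in>H.
     {u, v} \<in> E \<longrightarrow> {v, w} \<in> E \<longrightarrow> u \<noteq> w \<longrightarrow> {u, w} \<in> E)"

text \<open>For a \<open>P3_free\<close> set \<open>H\<close> these are the cliques of the graph induced on \<open>H\<close>; vertices outside \<open>H\<close>
form classes of their own, so that renaming leaves them in place.\<close>

definition clique_of :: "'v set set \<Rightarrow> 'v set \<Rightarrow> 'v \<Rightarrow> 'v set" where
  "clique_of E H v = {w. w = v \<or> v \<in> H \<and> w \<in> H \<and> {v, w} \<in> E}"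

lemma clique_of_self: "v \<in> clique_of E H v"
  by (simp add: clique_of_def)

lemma clique_of_outside: "v \<notin> H \<Longrightarrow> clique_of E H v = {v}"
  by (auto simp: clique_of_def)

lemma clique_of_eq:
  assumes "P3_free E H" "w \<in> clique_of E H v"
  shows "clique_of E H w = clique_of E H v"
proof (cases "w = v")
  case False
  then have *: "v \<in> H" "w \<in> H" "{v, w} \<in> E" "{w, v} \<in> E"
    using assms(2) by (auto simp: clique_of_def insert_commute)
  have "x \<in> clique_of E H w \<longleftrightarrow> x \<in> clique_of E H v" for x
  proof (cases "x = v \<or> x = w")
    case False
    have "{w, x} \<in> E \<longleftrightarrow> {v, x} \<in> E" if "x \<in> H"
      using assms(1) * that False unfolding P3_free_def by blast
    then show ?thesis using * False by (auto simp: clique_of_def)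
  qed (use * in \<open>auto simp: clique_of_def\<close>)
  then show ?thesis by auto
qed auto

lemma clique_of_adjacent:
  assumes "P3_free E H" "u \<in> clique_of E H v" "w \<in> clique_of E H v" "u \<noteq> w"
  shows "u \<in> H \<and> w \<in> H \<and> {u, w} \<in> E"
  using clique_of_eq[OF assms(1,2)] assms(3,4) by (auto simp: clique_of_def)

lemma cluster_graph_iff_P3_free:
  assumes E: "\<forall>e\<in>E. e \<subseteq> V \<and> card e = 2"
  shows "cluster_graph V E \<longleftrightarrow> P3_free E V"
proof
  assume "cluster_graph V E"
  then obtain P where P: "partition_on V P"
    and EP: "E = {{u, v} | u v. u \<noteq> v \<and> (\<exists>B\<in>P. u \<in> B \<and> v \<in> B)}"
    by (auto simp: cluster_graph_def)
  have mem: "{u, v} \<in> E \<longleftrightarrow> u \<noteq> v \<and> (\<exists>B\<in>P. u \<in> B \<and> v \<in> B)" for u v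
    unfolding EP by (auto simp: doubleton_eq_iff)
  have "B = B'" if "B \<in> P" "B' \<in> P" "v \<in> B" "v \<in> B'" for B B' v
    using P that by (auto simp: partition_on_def disjoint_def)
  then show "P3_free E V" unfolding P3_free_def mem by blast
next
  assume free: "P3_free E V"
  have part: "partition_on V (clique_of E V ` V)"
  proof (rule partition_onI)
    show "\<Union> (clique_of E V ` V) = V"
      using clique_of_self[of _ E V] by (auto simp: clique_of_def)
    show "disjnt p p'" if p: "p \<in> clique_of E V ` V" "p' \<in> clique_of E V ` V" "p \<noteq> p'" for p p'
    proof (rule ccontr)
      assume "\<not> disjnt p p'"
      then obtain x where "x \<in> p" "x \<in> p'" by (auto simp: disjnt_iff)
      then show False using p clique_of_eq[OF free] by blast
    qed
    show "{} \<notin> clique_of E V ` V"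
    proof
      assume "{} \<in> clique_of E V ` V"
      then obtain v where "clique_of E V v = {}" by auto
      then show False using clique_of_self[of v E V] by simp
    qed
  qed
  have "E = {{u, v} | u v. u \<noteq> v \<and> (\<exists>B\<in>clique_of E V ` V. u \<in> B \<and> v \<in> B)}" (is "_ = ?R")
  proof (intro equalityI subsetI)
    fix e assume "e \<in> E"
    then have "card e = 2" "e \<subseteq> V" using E by blast+
    then obtain u v where e: "e = {u, v}" "u \<noteq> v" by (meson card_2_iff)
    then have "u \<in> V" "v \<in> V" using \<open>e \<subseteq> V\<close> by auto
    then have "clique_of E V u \<in> clique_of E V ` V" "u \<in> clique_of E V u" "v \<in> clique_of E V u"
      using \<open>e \<in> E\<close> e by (simp_all add: clique_of_def)
    then show "e \<in> ?R" using e by blast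
  next
    fix e assume "e \<in> ?R"
    then obtain u v x where "e = {u, v}" "u \<noteq> v" "u \<in> clique_of E V x" "v \<in> clique_of E V x"
      by fast
    then show "e \<in> E" using clique_of_adjacent[OF free] by simp
  qed
  with part show "cluster_graph V E"
    unfolding cluster_graph_def by (intro exI conjI)
qed


section \<open>Renaming colors on a disjoint union of cliques\<close>

text \<open>Properness is required on \<open>H\<close> only: the converse direction renames colors on a part of the graph and
treats the remaining edges separately.\<close>

definition set_maps :: "'v set \<Rightarrow> 'v set set \<Rightarrow> 'v set \<Rightarrow> ('v \<Rightarrow> pos set) set" where
  "set_maps V E H = {\<kappa> \<in> V \<rightarrow>\<^sub>E {S. finite S \<and> S \<noteq> {}}.
     \<forall>u\<in>H. \<forall>w\<in>H. {u, w} \<in> E \<longrightarrow> \<kappa> u \<inter> \<kappa> w = {}}"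

text \<open>The vertex whose renamed color set is handed to \<open>v\<close>.\<close>

definition rename_vertex :: "'v set set \<Rightarrow> 'v set \<Rightarrow> (pos \<Rightarrow> pos) \<Rightarrow> ('v \<Rightarrow> pos set) \<Rightarrow> 'v \<Rightarrow> 'v" where
  "rename_vertex E H \<tau> \<kappa> v =
     align (\<lambda>w. Max (\<kappa> w)) (\<lambda>w. Max (\<tau> ` \<kappa> w)) (clique_of E H v) v"

definition rename :: "'v set \<Rightarrow> 'v set set \<Rightarrow> 'v set \<Rightarrow> (pos \<Rightarrow> pos) \<Rightarrow> ('v \<Rightarrow> pos set) \<Rightarrow> 'v \<Rightarrow> pos set" where
  "rename V E H \<tau> \<kappa> = (\<lambda>v\<in>V. \<tau> ` \<kappa> (rename_vertex E H \<tau> \<kappa> v))"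

lemma inj_on_Max:
  fixes \<kappa> :: "'v \<Rightarrow> 'a::linorder set"
  assumes "\<And>u. u \<in> K \<Longrightarrow> finite (\<kappa> u) \<and> \<kappa> u \<noteq> {}"
    and "\<And>u w. u \<in> K \<Longrightarrow> w \<in> K \<Longrightarrow> u \<noteq> w \<Longrightarrow> \<kappa> u \<inter> \<kappa> w = {}"
  shows "inj_on (\<lambda>u. Max (\<kappa> u)) K"
proof (rule inj_onI, rule ccontr)
  fix u w assume uw: "u \<in> K" "w \<in> K" "Max (\<kappa> u) = Max (\<kappa> w)" "u \<noteq> w"
  then have "Max (\<kappa> u) \<in> \<kappa> u \<inter> \<kappa> w" using assms(1)[of u] assms(1)[of w] by (metis IntI Max_in)
  then show False using assms(2)[OF uw(1,2,4)] by simp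
qed

locale clique_coloring =
  fixes V :: "'v set" and E :: "'v set set" and H :: "'v set" and \<kappa> :: "'v \<Rightarrow> pos set"
  assumes fin: "finite V" and HV: "H \<subseteq> V" and free: "P3_free E H"
    and \<kappa>: "\<kappa> \<in> set_maps V E H"
begin

lemma \<kappa>_fin: "v \<in> V \<Longrightarrow> finite (\<kappa> v) \<and> \<kappa> v \<noteq> {}"
  using \<kappa> by (auto simp: set_maps_def dest: PiE_mem)

lemma \<kappa>_disj: "u \<in> H \<Longrightarrow> w \<in> H \<Longrightarrow> {u, w} \<in> E \<Longrightarrow> \<kappa> u \<inter> \<kappa> w = {}"
  using \<kappa> by (auto simp: set_maps_def)

lemma clique_sub: "v \<in> V \<Longrightarrow> clique_of E H v \<subseteq> V"
  using HV by (auto simp: clique_of_def)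

lemma clique_fin: "v \<in> V \<Longrightarrow> finite (clique_of E H v)"
  using clique_sub fin by (meson finite_subset)

lemma inj_on_Max_clique:
  assumes "v \<in> V" "inj \<tau>"
  shows "inj_on (\<lambda>w. Max (\<tau> ` \<kappa> w)) (clique_of E H v)"
proof (rule inj_on_Max)
  show "finite (\<tau> ` \<kappa> u) \<and> \<tau> ` \<kappa> u \<noteq> {}" if "u \<in> clique_of E H v" for u
    using \<kappa>_fin clique_sub assms that by blast
  show "\<tau> ` \<kappa> u \<inter> \<tau> ` \<kappa> w = {}"
    if uw: "u \<in> clique_of E H v" "w \<in> clique_of E H v" "u \<noteq> w" for u w
    using \<kappa>_disj clique_of_adjacent[OF free uw] assms(2) by (simp add: image_Int[symmetric])
qed

lemmas inj_on_Max_clique_id = inj_on_Max_clique[where \<tau> = id, simplified]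

lemma rename_vertex_mem:
  assumes "v \<in> V" "inj \<tau>"
  shows "rename_vertex E H \<tau> \<kappa> v \<in> clique_of E H v"
  using align_position[OF clique_fin[OF assms(1)] inj_on_Max_clique_id[OF assms(1)]
      inj_on_Max_clique[OF assms] clique_of_self]
  by (simp add: rename_vertex_def)

lemma inj_on_rename_vertex:
  assumes "inj \<tau>"
  shows "inj_on (rename_vertex E H \<tau> \<kappa>) V"
proof (rule inj_onI)
  fix u v assume uv: "u \<in> V" "v \<in> V" "rename_vertex E H \<tau> \<kappa> u = rename_vertex E H \<tau> \<kappa> v"
  then have eq: "clique_of E H u = clique_of E H v"
    using clique_of_eq[OF free rename_vertex_mem[OF uv(1) assms]]
      clique_of_eq[OF free rename_vertex_mem[OF uv(2) assms]] by simp
  have "inj_on (align (\<lambda>w. Max (\<kappa> w)) (\<lambda>w. Max (\<tau> ` \<kappa> w)) (clique_of E H v)) (clique_of E H v)"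
    using uv assms by (intro inj_on_align clique_fin inj_on_Max_clique_id inj_on_Max_clique)
  then show "u = v"
    using uv(3) eq clique_of_self[of u E H] clique_of_self[of v E H]
    unfolding rename_vertex_def by (metis inj_onD)
qed

lemma bij_betw_rename_vertex:
  assumes "inj \<tau>"
  shows "bij_betw (rename_vertex E H \<tau> \<kappa>) V V"
proof -
  have "rename_vertex E H \<tau> \<kappa> ` V \<subseteq> V"
    using rename_vertex_mem[OF _ assms] clique_sub by blast
  then show ?thesis
    using inj_on_rename_vertex[OF assms] endo_inj_surj[OF fin] by (simp add: bij_betw_def)
qed

lemma rename_outside: "v \<in> V \<Longrightarrow> v \<notin> H \<Longrightarrow> inj \<tau> \<Longrightarrow> rename V E H \<tau> \<kappa> v = \<tau> ` \<kappa> v"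
  using rename_vertex_mem[of v \<tau>] by (simp add: rename_def clique_of_outside)

lemma rename_inside:
  assumes "v \<in> H" "inj \<tau>"
  shows "\<exists>w\<in>H. rename V E H \<tau> \<kappa> v = \<tau> ` \<kappa> w"
proof -
  have "v \<in> V" using assms HV by blast
  then show ?thesis
    using rename_vertex_mem[of v \<tau>] assms
    by (intro bexI[of _ "rename_vertex E H \<tau> \<kappa> v"]) (auto simp: rename_def clique_of_def)
qed

text \<open>Adjacent vertices of \<open>H\<close> share a clique, so they receive the images of the color sets of two different
vertices of that clique, which are disjoint.\<close>

lemma rename_mem_set_maps:
  assumes "inj \<tau>"
  shows "rename V E H \<tau> \<kappa> \<in> set_maps V E H"
proof -
  have V: "rename_vertex E H \<tau> \<kappa> v \<in> V" if "v \<in> V" for v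
    using rename_vertex_mem[OF that assms] clique_sub[OF that] by blast
  have "\<tau> ` \<kappa> (rename_vertex E H \<tau> \<kappa> u) \<inter> \<tau> ` \<kappa> (rename_vertex E H \<tau> \<kappa> w) = {}"
    if uw: "u \<in> H" "w \<in> H" "{u, w} \<in> E" for u w
  proof (cases "u = w")
    case True
    then show ?thesis using \<kappa>_disj[of u u] uw \<kappa>_fin HV by auto
  next
    case False
    have "w \<in> clique_of E H u" using uw by (auto simp: clique_of_def)
    then have "clique_of E H w = clique_of E H u" using clique_of_eq[OF free] by blast
    moreover have "rename_vertex E H \<tau> \<kappa> u \<noteq> rename_vertex E H \<tau> \<kappa> w"
      using inj_on_rename_vertex[OF assms] False uw HV by (auto dest: inj_onD)
    moreover have "rename_vertex E H \<tau> \<kappa> x \<in> clique_of E H x" if "x \<in> H" for x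
      using rename_vertex_mem[OF _ assms] that HV by blast
    ultimately have "\<kappa> (rename_vertex E H \<tau> \<kappa> u) \<inter> \<kappa> (rename_vertex E H \<tau> \<kappa> w) = {}"
      using uw by (intro \<kappa>_disj) (auto dest: clique_of_adjacent[OF free])
    then show ?thesis using assms by (simp add: image_Int[symmetric])
  qed
  then show ?thesis
    using V \<kappa>_fin HV by (auto simp: set_maps_def rename_def)
qed

lemma Max_rename_less_iff:
  assumes "inj \<tau>" "u \<in> V" "w \<in> clique_of E H u"
  shows "Max (rename V E H \<tau> \<kappa> u) < Max (rename V E H \<tau> \<kappa> w) \<longleftrightarrow> Max (\<kappa> u) < Max (\<kappa> w)"
proof -
  have "w \<in> V" using assms clique_sub by blast
  then show ?thesis
    using align_less_iff[OF clique_fin[OF assms(2)] inj_on_Max_clique_id[OF assms(2)]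
        inj_on_Max_clique[OF assms(2,1)] clique_of_self assms(3)] assms(2)
    by (simp add: rename_def rename_vertex_def clique_of_eq[OF free assms(3)])
qed

text \<open>The vertices are permuted and the colors are renamed, so the color \<open>\<tau> j\<close> takes over the number of
occurrences of \<open>j\<close>.\<close>

lemma card_rename:
  assumes "bij \<tau>"
  shows "card {v \<in> V. \<tau> j \<in> rename V E H \<tau> \<kappa> v} = card {v \<in> V. j \<in> \<kappa> v}"
proof -
  let ?p = "rename_vertex E H \<tau> \<kappa>"
  have inj: "inj \<tau>" using assms by (simp add: bij_is_inj)
  have "{v \<in> V. \<tau> j \<in> rename V E H \<tau> \<kappa> v} = {v \<in> V. j \<in> \<kappa> (?p v)}"
    using inj by (auto simp: rename_def inj_image_mem_iff)
  moreover have "bij_betw ?p {v \<in> V. j \<in> \<kappa> (?p v)} {v \<in> V. j \<in> \<kappa> v}"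
    using bij_betw_rename_vertex[OF inj] unfolding bij_betw_def inj_on_def by auto
  ultimately show ?thesis by (simp add: bij_betw_same_card)
qed

end

text \<open>Renaming forth and back gives \<open>\<kappa> \<circ> p\<close>, where \<open>p\<close> permutes each clique and preserves the order of the maxima
twice over, so \<open>p\<close> is the identity.\<close>

lemma rename_inverse:
  assumes "finite V" "H \<subseteq> V" "P3_free E H" "\<kappa> \<in> set_maps V E H" and \<tau>: "bij \<tau>"
  shows "rename V E H (inv \<tau>) (rename V E H \<tau> \<kappa>) = \<kappa>"
proof
  fix v
  have inj: "inj \<tau>" "inj (inv \<tau>)" using \<tau> by (auto simp: bij_is_inj bij_imp_bij_inv)
  let ?l = "rename V E H \<tau> \<kappa>"
  interpret a: clique_coloring V E H \<kappa> using assms by unfold_locales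
  interpret b: clique_coloring V E H ?l
    using assms a.rename_mem_set_maps[OF inj(1)] by unfold_locales
  let ?p = "rename_vertex E H \<tau> \<kappa>" and ?q = "rename_vertex E H (inv \<tau>) ?l"
  show "rename V E H (inv \<tau>) ?l v = \<kappa> v"
  proof (cases "v \<in> V")
    case False
    then show ?thesis using assms(4) by (auto simp: rename_def set_maps_def PiE_def extensional_def)
  next
    case v: True
    let ?K = "clique_of E H v"
    have KV: "?K \<subseteq> V" using a.clique_sub v by blast
    have K_eq: "clique_of E H u = ?K" if "u \<in> ?K" for u
      using clique_of_eq[OF assms(3)] that by blast
    have q: "?q u \<in> ?K" if "u \<in> ?K" for u
      using b.rename_vertex_mem[OF _ inj(2), of u] K_eq[OF that] KV that by auto
    have p: "?p u \<in> ?K" if "u \<in> ?K" for u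
      using a.rename_vertex_mem[OF _ inj(1), of u] K_eq[OF that] KV that by auto
    have eq: "rename V E H (inv \<tau>) ?l u = \<kappa> (?p (?q u))" if "u \<in> ?K" for u
      using q[OF that] KV that inj(1) by (auto simp: rename_def image_image)
    have "inj_on (\<lambda>u. ?p (?q u)) ?K"
    proof (rule inj_onI)
      fix u w assume uw: "u \<in> ?K" "w \<in> ?K" "?p (?q u) = ?p (?q w)"
      have "?q u \<in> V" "?q w \<in> V" using q uw KV by blast+
      then have "?q u = ?q w" by (rule inj_onD[OF a.inj_on_rename_vertex[OF inj(1)] uw(3)])
      then show "u = w"
        using uw KV inj_onD[OF b.inj_on_rename_vertex[OF inj(2)]] by blast
    qed
    then have bij: "bij_betw (\<lambda>u. ?p (?q u)) ?K ?K"
      using endo_inj_surj[OF a.clique_fin[OF v]] p q by (simp add: bij_betw_def image_subset_iff)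
    have "?p (?q v) = v"
    proof (rule order_preserving_permutation_eq_id[OF a.clique_fin[OF v]
          a.inj_on_Max_clique_id[OF v] bij _ clique_of_self])
      fix u w assume uw: "u \<in> ?K" "w \<in> ?K"
      then show "Max (\<kappa> (?p (?q u))) < Max (\<kappa> (?p (?q w))) \<longleftrightarrow> Max (\<kappa> u) < Max (\<kappa> w)"
        using a.Max_rename_less_iff[OF inj(1), of u w] b.Max_rename_less_iff[OF inj(2), of u w]
          K_eq[OF uw(1)] subsetD[OF KV uw(1)] eq[OF uw(1)] eq[OF uw(2)] by simp
    qed
    then show ?thesis using eq[OF clique_of_self] by simp
  qed
qed


section \<open>Coefficients as numbers of colorings\<close>

definition color_count :: "'v set \<Rightarrow> ('v \<Rightarrow> pos set) \<Rightarrow> pos \<Rightarrow> nat" where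
  "color_count V \<kappa> j = card {v \<in> V. j \<in> \<kappa> v}"

definition colorings_with ::
    "'v set \<Rightarrow> 'v set set \<Rightarrow> ('v \<times> 'v) set \<Rightarrow> nat \<Rightarrow> (pos \<Rightarrow> nat) \<Rightarrow> ('v \<Rightarrow> pos set) set" where
  "colorings_with V E r i d =
     {\<kappa> \<in> proper_colorings V E. asc E r (Max \<circ> \<kappa>) = i \<and> color_count V \<kappa> = d}"

lemma proper_colorings_mem:
  "\<kappa> \<in> proper_colorings V E \<Longrightarrow> v \<in> V \<Longrightarrow> finite (\<kappa> v) \<and> \<kappa> v \<noteq> {}"
  by (auto simp: proper_colorings_def dest: PiE_mem)

lemma proper_colorings_eq_set_maps:
  assumes "\<forall>e\<in>E. e \<subseteq> V \<and> card e = 2"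
  shows "proper_colorings V E = set_maps V E V"
proof -
  have "u \<in> V \<and> v \<in> V" if "{u, v} \<in> E" for u v
    using assms that by blast
  then show ?thesis unfolding proper_colorings_def set_maps_def by blast
qed

lemma lookup_coloring_monomial:
  assumes "finite V" "\<kappa> \<in> proper_colorings V E"
  shows "Poly_Mapping.lookup (\<Sum>v\<in>V. \<Sum>j\<in>\<kappa> v. Poly_Mapping.single j (1::nat)) = color_count V \<kappa>"
proof
  fix i
  have "(\<Sum>j\<in>\<kappa> v. Poly_Mapping.lookup (Poly_Mapping.single j (1::nat)) i) = (if i \<in> \<kappa> v then 1 else 0)"
    if "v \<in> V" for v
  proof -
    have "(\<Sum>j\<in>\<kappa> v. Poly_Mapping.lookup (Poly_Mapping.single j (1::nat)) i) =
        (\<Sum>j\<in>\<kappa> v. if j = i then 1 else 0)"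
      by (intro sum.cong refl) (simp add: lookup_single when_def)
    also have "\<dots> = (if i \<in> \<kappa> v then 1 else 0)"
      using proper_colorings_mem[OF assms(2) that] by (subst sum.delta) auto
    finally show ?thesis .
  qed
  then have "Poly_Mapping.lookup (\<Sum>v\<in>V. \<Sum>j\<in>\<kappa> v. Poly_Mapping.single j (1::nat)) i =
      (\<Sum>v\<in>V. if i \<in> \<kappa> v then 1 else 0)"
    by (simp add: lookup_sum)
  also have "\<dots> = color_count V \<kappa> i"
    using assms(1) by (simp add: color_count_def sum.If_cases Int_def)
  finally show "Poly_Mapping.lookup (\<Sum>v\<in>V. \<Sum>j\<in>\<kappa> v. Poly_Mapping.single j (1::nat)) i = color_count V \<kappa> i" .
qed

lemma coeff_Lbar_eq_card:
  assumes "ordered_graph V E r"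
  shows "mps_coeff (coeff (Lbar V E r :: 'k::comm_ring_1 mps poly) i) m =
    of_nat (card (colorings_with V E r i (Poly_Mapping.lookup m)))"
proof -
  have "finite V" using assms by (simp add: ordered_graph_def)
  then have "(\<Sum>v\<in>V. \<Sum>j\<in>\<kappa> v. Poly_Mapping.single j 1) = m \<longleftrightarrow> color_count V \<kappa> = Poly_Mapping.lookup m"
    if "\<kappa> \<in> proper_colorings V E" for \<kappa>
    using lookup_coloring_monomial[OF _ that] by (metis lookup_inject)
  then have "{\<kappa> \<in> proper_colorings V E. asc E r (Max \<circ> \<kappa>) = i \<and>
      (\<Sum>v\<in>V. \<Sum>j\<in>\<kappa> v. Poly_Mapping.single j 1) = m} = colorings_with V E r i (Poly_Mapping.lookup m)"
    unfolding colorings_with_def by blast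
  then show ?thesis by (simp add: coeff_Lbar[OF assms])
qed

lemma Lbar_symmetric_iff:
  assumes "ordered_graph V E r"
  shows "(Lbar V E r :: 'k::{idom, ring_char_0} mps poly) \<in> mSym_q \<longleftrightarrow>
    (\<forall>i \<sigma> m. bij \<sigma> \<longrightarrow> card (colorings_with V E r i (Poly_Mapping.lookup m \<circ> \<sigma>)) =
      card (colorings_with V E r i (Poly_Mapping.lookup m)))"
  by (auto simp: mSym_q_def mSym_def coeff_Lbar_eq_card[OF assms] map_key.rep_eq bij_is_inj)

lemma finite_colorings_with:
  assumes "finite V" "finite {j. d j \<noteq> 0}"
  shows "finite (colorings_with V E r i d)"
proof (rule finite_subset)
  show "finite (V \<rightarrow>\<^sub>E Pow {j. d j \<noteq> 0})" using assms by (intro finite_PiE) auto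
  show "colorings_with V E r i d \<subseteq> V \<rightarrow>\<^sub>E Pow {j. d j \<noteq> 0}"
  proof
    fix \<kappa> assume \<kappa>: "\<kappa> \<in> colorings_with V E r i d"
    have "\<kappa> v \<subseteq> {j. d j \<noteq> 0}" if "v \<in> V" for v
    proof
      fix j assume "j \<in> \<kappa> v"
      then have "color_count V \<kappa> j \<noteq> 0" using that assms(1) by (auto simp: color_count_def)
      then show "j \<in> {j. d j \<noteq> 0}" using \<kappa> by (simp add: colorings_with_def)
    qed
    moreover have "\<kappa> \<in> extensional V"
      using \<kappa> by (simp add: colorings_with_def proper_colorings_def PiE_def)
    ultimately show "\<kappa> \<in> V \<rightarrow>\<^sub>E Pow {j. d j \<noteq> 0}" by (simp add: PiE_iff)
  qed
qed

lemma asc_cong: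
  assumes "\<And>u v. {u, v} \<in> E \<Longrightarrow> c u < c v \<longleftrightarrow> c' u < c' v"
  shows "asc E r c = asc E r c'"
proof -
  have "{e \<in> E. \<exists>u v. e = {u, v} \<and> (u, v) \<in> r \<and> u \<noteq> v \<and> c u < c v} =
      {e \<in> E. \<exists>u v. e = {u, v} \<and> (u, v) \<in> r \<and> u \<noteq> v \<and> c' u < c' v}"
    using assms by blast
  then show ?thesis by (simp add: asc_def)
qed


section \<open>Cluster graphs have symmetric counts\<close>

lemma rename_mem_colorings_with:
  assumes og: "ordered_graph V E r" and free: "P3_free E V" and \<tau>: "bij \<tau>"
    and \<kappa>: "\<kappa> \<in> colorings_with V E r i d"
  shows "rename V E V \<tau> \<kappa> \<in> colorings_with V E r i (d \<circ> inv \<tau>)"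
proof -
  have E: "\<forall>e\<in>E. e \<subseteq> V \<and> card e = 2" and "finite V" using og by (auto simp: ordered_graph_def)
  have inj: "inj \<tau>" using \<tau> by (rule bij_is_inj)
  have proper_eq: "proper_colorings V E = set_maps V E V"
    using E by (rule proper_colorings_eq_set_maps)
  interpret clique_coloring V E V \<kappa>
    using \<kappa> \<open>finite V\<close> free proper_eq by unfold_locales (auto simp: colorings_with_def)
  have "asc E r (Max \<circ> rename V E V \<tau> \<kappa>) = asc E r (Max \<circ> \<kappa>)"
  proof (rule asc_cong)
    fix u v assume "{u, v} \<in> E"
    moreover from this have "u \<in> V" "v \<in> V" using E by blast+
    ultimately show "(Max \<circ> rename V E V \<tau> \<kappa>) u < (Max \<circ> rename V E V \<tau> \<kappa>) v \<longleftrightarrow>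
        (Max \<circ> \<kappa>) u < (Max \<circ> \<kappa>) v"
      using Max_rename_less_iff[OF inj, of u v] by (simp add: clique_of_def)
  qed
  moreover have "color_count V (rename V E V \<tau> \<kappa>) j = color_count V \<kappa> (inv \<tau> j)" for j
    using card_rename[OF \<tau>, of "inv \<tau> j"] \<tau> by (simp add: color_count_def surj_f_inv_f bij_is_surj)
  ultimately show ?thesis
    using assms(4) rename_mem_set_maps[OF inj] by (auto simp: colorings_with_def proper_eq)
qed

lemma card_colorings_with_le:
  assumes og: "ordered_graph V E r" and free: "P3_free E V" and \<sigma>: "bij \<sigma>"
    and d: "finite {j. d j \<noteq> 0}"
  shows "card (colorings_with V E r i d) \<le> card (colorings_with V E r i (d \<circ> \<sigma>))"
proof (rule card_inj_on_le)
  have E: "\<forall>e\<in>E. e \<subseteq> V \<and> card e = 2" and "finite V" using og by (auto simp: ordered_graph_def)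
  have \<tau>: "bij (inv \<sigma>)" and inv: "inv (inv \<sigma>) = \<sigma>"
    using \<sigma> by (auto simp: bij_imp_bij_inv inv_inv_eq)
  show "rename V E V (inv \<sigma>) ` colorings_with V E r i d \<subseteq> colorings_with V E r i (d \<circ> \<sigma>)"
    using rename_mem_colorings_with[OF og free \<tau>] by (auto simp: inv)
  have "colorings_with V E r i d \<subseteq> set_maps V E V"
    using proper_colorings_eq_set_maps[OF E] by (auto simp: colorings_with_def)
  then show "inj_on (rename V E V (inv \<sigma>)) (colorings_with V E r i d)"
    using rename_inverse[OF \<open>finite V\<close> order_refl free _ \<tau>]
    by (intro inj_on_inverseI[where g = "rename V E V (inv (inv \<sigma>))"]) blast
  have "finite {j. (d \<circ> \<sigma>) j \<noteq> 0}"
    using finite_vimageI[OF d bij_is_inj[OF \<sigma>]] by (simp add: vimage_def)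
  then show "finite (colorings_with V E r i (d \<circ> \<sigma>))"
    by (rule finite_colorings_with[OF \<open>finite V\<close>])
qed

lemma cluster_graph_card_colorings_with:
  assumes og: "ordered_graph V E r" and free: "P3_free E V" and \<sigma>: "bij \<sigma>"
    and d: "finite {j. d j \<noteq> 0}"
  shows "card (colorings_with V E r i (d \<circ> \<sigma>)) = card (colorings_with V E r i d)"
proof (rule antisym)
  have "finite {j. (d \<circ> \<sigma>) j \<noteq> 0}"
    using finite_vimageI[OF d bij_is_inj[OF \<sigma>]] by (simp add: vimage_def)
  then have "card (colorings_with V E r i (d \<circ> \<sigma>)) \<le>
      card (colorings_with V E r i (d \<circ> \<sigma> \<circ> inv \<sigma>))"
    by (rule card_colorings_with_le[OF og free bij_imp_bij_inv[OF \<sigma>]])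
  then show "card (colorings_with V E r i (d \<circ> \<sigma>)) \<le> card (colorings_with V E r i d)"
    using surj_iff[THEN iffD1, OF bij_is_surj[OF \<sigma>]] by (simp add: o_assoc[symmetric])
qed (rule card_colorings_with_le[OF assms])


section \<open>Up-closed sets of an ordered graph\<close>

definition arc :: "'v set set \<Rightarrow> ('v \<times> 'v) set \<Rightarrow> 'v \<Rightarrow> 'v \<Rightarrow> bool" where
  "arc E r u v \<longleftrightarrow> {u, v} \<in> E \<and> (u, v) \<in> r \<and> u \<noteq> v"

definition sinks :: "'v set \<Rightarrow> 'v set set \<Rightarrow> ('v \<times> 'v) set \<Rightarrow> 'v set" where
  "sinks V E r = {u \<in> V. \<forall>v. \<not> arc E r u v}"

definition up_closed :: "'v set \<Rightarrow> 'v set set \<Rightarrow> ('v \<times> 'v) set \<Rightarrow> 'v set \<Rightarrow> bool" where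
  "up_closed V E r C \<longleftrightarrow> C \<subseteq> V \<and> (\<forall>u\<in>C. \<forall>v. arc E r u v \<longrightarrow> v \<in> C)"

definition stable_set :: "'v set set \<Rightarrow> 'v set \<Rightarrow> bool" where
  "stable_set E S \<longleftrightarrow> (\<forall>u\<in>S. \<forall>v\<in>S. {u, v} \<notin> E)"

definition vertex_rank :: "'v set \<Rightarrow> ('v \<times> 'v) set \<Rightarrow> 'v \<Rightarrow> nat" where
  "vertex_rank V r u = card {x \<in> V. (x, u) \<in> r \<and> x \<noteq> u}"

locale ord_graph =
  fixes V :: "'v set" and E :: "'v set set" and r :: "('v \<times> 'v) set"
  assumes og: "ordered_graph V E r"
begin

abbreviation "n \<equiv> card V"
abbreviation "\<rho> \<equiv> vertex_rank V r"
abbreviation "L \<equiv> sinks V E r"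

lemma fin: "finite V" and edges: "\<forall>e\<in>E. e \<subseteq> V \<and> card e = 2"
  using og by (auto simp: ordered_graph_def)

lemma finE: "finite E"
  using edges fin by (intro finite_subset[of E "Pow V"]) auto

lemma linear_r: "linear_order_on V r"
  using og by (simp add: ordered_graph_def)

lemma antisym_r: "(u, v) \<in> r \<Longrightarrow> (v, u) \<in> r \<Longrightarrow> u = v"
  using linear_r unfolding order_on_defs by (meson antisymD)

lemma trans_r: "(u, v) \<in> r \<Longrightarrow> (v, w) \<in> r \<Longrightarrow> (u, w) \<in> r"
  using linear_r unfolding order_on_defs by (meson transD)

lemma total_r: "u \<in> V \<Longrightarrow> v \<in> V \<Longrightarrow> u \<noteq> v \<Longrightarrow> (u, v) \<in> r \<or> (v, u) \<in> r"
  using linear_r unfolding order_on_defs total_on_def by blast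

lemma edgeD: "{u, v} \<in> E \<Longrightarrow> u \<in> V \<and> v \<in> V \<and> u \<noteq> v"
proof -
  assume e: "{u, v} \<in> E"
  then have "{u, v} \<subseteq> V" "card {u, v} = 2" using edges by blast+
  then show ?thesis by (cases "u = v") auto
qed

lemma no_loop: "{v} \<notin> E"
  using edgeD[of v v] by auto

lemma edge_arc: "{u, v} \<in> E \<Longrightarrow> arc E r u v \<or> arc E r v u"
  using edgeD[of u v] total_r[of u v] unfolding arc_def insert_commute[of v u] by blast

lemma arcD: "arc E r u v \<Longrightarrow> u \<in> V \<and> v \<in> V \<and> u \<noteq> v \<and> {u, v} \<in> E \<and> {v, u} \<in> E"
  using edgeD[of u v] unfolding arc_def insert_commute[of v u] by blast

lemma vertex_rank_less:
  assumes "u \<in> V" "(u, v) \<in> r" "u \<noteq> v"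
  shows "\<rho> u < \<rho> v"
  unfolding vertex_rank_def
proof (rule psubset_card_mono)
  show "finite {x \<in> V. (x, v) \<in> r \<and> x \<noteq> v}" using fin by simp
  have "x \<noteq> v" if "(x, u) \<in> r" for x using that assms antisym_r by blast
  then show "{x \<in> V. (x, u) \<in> r \<and> x \<noteq> u} \<subset> {x \<in> V. (x, v) \<in> r \<and> x \<noteq> v}"
    using assms trans_r by blast
qed

lemma vertex_rank_arc: "arc E r u v \<Longrightarrow> \<rho> u < \<rho> v"
  using vertex_rank_less edgeD unfolding arc_def by blast

lemma inj_on_vertex_rank: "inj_on \<rho> V"
proof (rule inj_onI, rule ccontr)
  fix u v assume uv: "u \<in> V" "v \<in> V" "\<rho> u = \<rho> v" "u \<noteq> v"
  then show False
    using total_r[OF uv(1,2,4)] vertex_rank_less[of u v] vertex_rank_less[of v u] by auto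
qed

lemma vertex_rank_lt: "u \<in> V \<Longrightarrow> \<rho> u < n"
  unfolding vertex_rank_def using fin by (intro psubset_card_mono) auto

text \<open>Colorings that contribute to the top power of \<open>q\<close> are those that increase along every arc.\<close>

lemma asc_eq_card_iff: "asc E r c = card E \<longleftrightarrow> (\<forall>u v. arc E r u v \<longrightarrow> c u < c v)"
proof -
  let ?A = "{e \<in> E. \<exists>u v. e = {u, v} \<and> (u, v) \<in> r \<and> u \<noteq> v \<and> c u < c v}"
  have "asc E r c = card E \<longleftrightarrow> ?A = E"
    unfolding asc_def using card_subset_eq[OF finE, of ?A] by auto
  also have "\<dots> \<longleftrightarrow> (\<forall>u v. arc E r u v \<longrightarrow> c u < c v)"
  proof
    assume A: "?A = E"
    show "\<forall>u v. arc E r u v \<longrightarrow> c u < c v"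
    proof (intro allI impI)
      fix u v assume uv: "arc E r u v"
      then have "{u, v} \<in> ?A" using A by (simp add: arc_def)
      then obtain x y where "{u, v} = {x, y}" "(x, y) \<in> r" "c x < c y" by blast
      then have "u = x \<and> v = y \<or> u = y \<and> v = x" by (simp add: doubleton_eq_iff)
      then show "c u < c v"
        using uv antisym_r[of u v] \<open>(x, y) \<in> r\<close> \<open>c x < c y\<close> by (auto simp: arc_def)
    qed
  next
    assume inc: "\<forall>u v. arc E r u v \<longrightarrow> c u < c v"
    have "e \<in> ?A" if "e \<in> E" for e
    proof -
      have "card e = 2" using edges that by blast
      then obtain u v where "e = {u, v}" by (meson card_2_iff)
      then consider "arc E r u v" | "arc E r v u" using edge_arc[of u v] \<open>e \<in> E\<close> by blast
      then show ?thesis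
      proof cases
        case 1
        then show ?thesis using that inc \<open>e = {u, v}\<close> unfolding arc_def by blast
      next
        case 2
        then have "e = {v, u}" "(v, u) \<in> r" "v \<noteq> u" "c v < c u"
          using inc \<open>e = {u, v}\<close> by (auto simp: arc_def)
        then show ?thesis using that by blast
      qed
    qed
    then show "?A = E" by blast
  qed
  finally show ?thesis .
qed

lemma stable_sinks: "stable_set E L"
  using edge_arc by (auto simp: stable_set_def sinks_def)

lemma up_closed_remove_source:
  assumes "up_closed V E r C" "\<forall>w\<in>C. \<not> arc E r w s"
  shows "up_closed V E r (C - {s})"
  using assms by (auto simp: up_closed_def)

text \<open>No arc leaves \<open>C\<close> and none starts at a sink, so a stable set inside \<open>C\<close> remains stable after adding all sinks
outside \<open>C\<close>.\<close>

lemma stable_le_sinks_of_up_closed: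
  assumes max: "\<And>S. S \<subseteq> V \<Longrightarrow> stable_set E S \<Longrightarrow> card S \<le> card L"
    and C: "up_closed V E r C" and S: "S \<subseteq> C" "stable_set E S"
  shows "card S \<le> card (L \<inter> C)"
proof -
  have CV: "C \<subseteq> V" using C by (simp add: up_closed_def)
  have LV: "L \<subseteq> V" by (auto simp: sinks_def)
  have cross: "{s, t} \<notin> E \<and> {t, s} \<notin> E" if "s \<in> S" "t \<in> L - C" for s t
  proof -
    have "\<not> arc E r s t" using that S C unfolding up_closed_def by blast
    moreover have "\<not> arc E r t s" using that by (simp add: sinks_def)
    ultimately show ?thesis using edge_arc[of s t] edge_arc[of t s] by blast
  qed
  then have "stable_set E (S \<union> (L - C))"
    using S(2) stable_sinks cross cross unfolding stable_set_def by blast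
  then have "card (S \<union> (L - C)) \<le> card L"
    using CV LV S by (intro max) auto
  moreover have "card (S \<union> (L - C)) = card S + card (L - C)"
    using S CV LV fin by (intro card_Un_disjoint) (auto intro: finite_subset)
  moreover have "card L = card (L \<inter> C) + card (L - C)"
    using LV fin by (metis card_Diff_subset_Int card_Int_Diff finite_subset)
  ultimately show ?thesis by linarith
qed

end

text \<open>A smallest up-closed obstruction, together with the bound on stable sets that symmetry provides.\<close>

locale minimal_up_closed = ord_graph V E r for V :: "'v set" and E and r +
  fixes C :: "'v set"
  assumes max: "\<And>S. S \<subseteq> V \<Longrightarrow> stable_set E S \<Longrightarrow> card S \<le> card L"
    and up: "up_closed V E r C" and not_free: "\<not> P3_free E C"
    and minimal: "\<And>D. up_closed V E r D \<Longrightarrow> card D < card C \<Longrightarrow> P3_free E D"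
begin

definition source :: "'v \<Rightarrow> bool" where
  "source s \<longleftrightarrow> s \<in> C \<and> (\<forall>w\<in>C. \<not> arc E r w s)"

lemma CV: "C \<subseteq> V" and arc_up: "u \<in> C \<Longrightarrow> arc E r u v \<Longrightarrow> v \<in> C"
  using up by (auto simp: up_closed_def)

lemma finC: "finite C"
  using CV fin by (rule finite_subset)

lemma free_remove_source: "source s \<Longrightarrow> P3_free E (C - {s})"
  unfolding source_def by (intro minimal up_closed_remove_source up card_Diff1_less finC) auto

text \<open>Every source lies on every induced path in \<open>C\<close>, since deleting it destroys all of them.\<close>

lemma obtain_P3:
  obtains x y z where "x \<in> C" "y \<in> C" "z \<in> C" "{x, y} \<in> E" "{y, z} \<in> E" "x \<noteq> z" "{x, z} \<notin> E"
    "\<And>s. source s \<Longrightarrow> s \<in> {x, y, z}"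
proof -
  obtain x y z where P: "x \<in> C" "y \<in> C" "z \<in> C" "{x, y} \<in> E" "{y, z} \<in> E" "x \<noteq> z" "{x, z} \<notin> E"
    using not_free unfolding P3_free_def by blast
  moreover have "s \<in> {x, y, z}" if "source s" for s
    using free_remove_source[OF that] P unfolding P3_free_def by blast
  ultimately show ?thesis using that by blast
qed

text \<open>The two ends of an induced path form a stable set.\<close>

lemma two_le_card_sinks: "2 \<le> card (L \<inter> C)"
proof -
  obtain x y z where P: "x \<in> C" "z \<in> C" "x \<noteq> z" "{x, z} \<notin> E" using obtain_P3 by metis
  then have "stable_set E {x, z}" using no_loop by (auto simp: stable_set_def insert_commute)
  then have "card {x, z} \<le> card (L \<inter> C)"
    using P by (intro stable_le_sinks_of_up_closed[OF max up]) auto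
  then show ?thesis using P by simp
qed

lemma source_not_sink:
  assumes "source s"
  shows "s \<notin> L"
proof -
  obtain x y z where P: "x \<in> C" "y \<in> C" "z \<in> C" "{x, y} \<in> E" "{y, z} \<in> E" "s \<in> {x, y, z}"
    using obtain_P3 assms by metis
  then obtain w where "w \<in> C" "{s, w} \<in> E" by (auto simp: insert_commute)
  then have "arc E r s w" using edge_arc assms by (auto simp: source_def)
  then show ?thesis by (auto simp: sinks_def)
qed

text \<open>Two sources would be the ends of an induced path with a middle vertex \<open>y\<close>. At most one sink of \<open>C\<close> is
adjacent to \<open>s'\<close>, and \<open>s\<close> is adjacent to no further one. Exchanging
that sink, if there is one, for \<open>s\<close> and \<open>s'\<close> enlarges the set of sinks in \<open>C\<close> to a bigger stable set, which is impossible.\<close>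

lemma source_unique:
  assumes s: "source s" and s': "source s'"
  shows "s = s'"
proof (rule ccontr)
  assume ne: "s \<noteq> s'"
  have nonadj: "{s, s'} \<notin> E"
    using edge_arc[of s s'] s s' by (auto simp: source_def)
  \<comment> \<open>both sources lie on an induced path and are not adjacent, so they are its two ends\<close>
  have "\<exists>y\<in>C. {s, y} \<in> E \<and> {s', y} \<in> E"
  proof -
    obtain x y z where P: "x \<in> C" "y \<in> C" "z \<in> C" "{x, y} \<in> E" "{y, z} \<in> E"
      "s \<in> {x, y, z}" "s' \<in> {x, y, z}"
      using obtain_P3 s s' by metis
    have "{s, y} \<in> E \<and> {s', y} \<in> E"
      using P ne nonadj by (auto simp: insert_commute)
    then show ?thesis using P by blast
  qed
  then obtain y where y: "y \<in> C" "{s, y} \<in> E" "{s', y} \<in> E" by blast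
  have mem: "s \<in> C" "s' \<in> C" using s s' by (auto simp: source_def)
  have yne: "y \<noteq> s" "y \<noteq> s'" using y edgeD by blast+
  have notL: "s \<notin> L" "s' \<notin> L" using s s' source_not_sink by auto
  \<comment> \<open>adjacency is transitive on triples of C that avoid one of the two sources\<close>
  have free: "{a, c} \<in> E" if "{a, b} \<in> E" "{b, c} \<in> E" "a \<noteq> c" "a \<in> C" "b \<in> C" "c \<in> C"
    "s \<notin> {a, b, c} \<or> s' \<notin> {a, b, c}" for a b c
    using free_remove_source[OF s] free_remove_source[OF s'] that unfolding P3_free_def by blast
  \<comment> \<open>the sinks adjacent to s', which have to give way\<close>
  define T where "T = {t \<in> L \<inter> C. {s', t} \<in> E}"
  have finL: "finite (L \<inter> C)" using finC by simp
  have finT: "finite T" using finL by (rule rev_finite_subset) (auto simp: T_def)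
  have Tle: "card T \<le> 1"
  proof -
    have "t = t'" if "t \<in> T" "t' \<in> T" for t t'
    proof (rule ccontr)
      assume "t \<noteq> t'"
      then have "{t, t'} \<in> E"
        using that notL mem ne by (intro free[of t s' t']) (auto simp: T_def insert_commute)
      then show False using that stable_sinks by (auto simp: T_def stable_set_def)
    qed
    then show ?thesis using finT by (simp add: card_le_Suc0_iff_eq)
  qed
  have s_nonadj: "{s, t} \<notin> E" if t: "t \<in> L \<inter> C - T" for t
  proof
    assume st: "{s, t} \<in> E"
    have tn: "t \<noteq> s" "t \<noteq> s'" using t notL by auto
    have "{s', t} \<notin> E" using t by (simp add: T_def)
    then have "t \<noteq> y" using y by auto
    have "{y, t} \<in> E"
      using y st t tn yne mem ne \<open>t \<noteq> y\<close> by (intro free[of y s t]) (auto simp: insert_commute)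
    then have "{s', t} \<in> E"
      using y st t tn yne mem ne \<open>t \<noteq> y\<close> by (intro free[of s' y t]) auto
    then show False using t unfolding T_def by blast
  qed
  let ?S = "insert s (insert s' (L \<inter> C - T))"
  have "{a, b} \<notin> E" if "a \<in> L \<inter> C - T" "b \<in> L \<inter> C - T" for a b
    using stable_sinks that by (simp add: stable_set_def)
  moreover have "{s', t} \<notin> E" if "t \<in> L \<inter> C - T" for t using that by (simp add: T_def)
  ultimately have "stable_set E ?S"
    using nonadj s_nonadj no_loop unfolding stable_set_def by (auto simp: insert_commute)
  then have "card ?S \<le> card (L \<inter> C)"
    using mem by (intro stable_le_sinks_of_up_closed[OF max up]) auto
  moreover have "card ?S = Suc (Suc (card (L \<inter> C - T)))"
    using ne notL finL by simp
  moreover have "card (L \<inter> C - T) = card (L \<inter> C) - card T"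
    using finT by (intro card_Diff_subset) (auto simp: T_def)
  ultimately show False using Tle by linarith
qed

text \<open>A vertex of \<open>C\<close> with the least value of \<open>f\<close> is a source, and there is only one source.\<close>

lemma source_least:
  fixes f :: "'v \<Rightarrow> 'a::linorder"
  assumes s: "source s" and f: "\<And>u v. u \<in> C \<Longrightarrow> v \<in> C \<Longrightarrow> arc E r u v \<Longrightarrow> f u < f v"
    and u: "u \<in> C" "u \<noteq> s"
  shows "f s < f u"
proof -
  have min_source: "source v" if "v \<in> C" "\<forall>w\<in>C. f v \<le> f w" for v
    using that f unfolding source_def by (meson leD)
  obtain v where v: "v \<in> C" "\<forall>w\<in>C. f v \<le> f w"
    using finC u(1) arg_min_if_finite(1)[of C f] arg_min_least[of C _ f] by (metis empty_iff)
  have "s = v" using source_unique[OF s min_source[OF v]] .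
  then have "f s \<le> f u" using v u by blast
  moreover have "f s \<noteq> f u"
  proof
    assume "f s = f u"
    then have "source u" using v \<open>s = v\<close> u by (intro min_source) auto
    then show False using source_unique[OF s] u by blast
  qed
  ultimately show ?thesis by simp
qed

lemma obtain_source: obtains s where "source s"
proof -
  obtain v where "v \<in> C" "\<forall>w\<in>C. \<rho> v \<le> \<rho> w"
    using finC not_free arg_min_if_finite(1)[of C \<rho>] arg_min_least[of C _ \<rho>]
    unfolding P3_free_def by (metis empty_iff)
  then have "source v" unfolding source_def using vertex_rank_arc by (meson leD)
  then show ?thesis by (rule that)
qed

end


section \<open>Asymmetry of graphs that are not cluster graphs\<close>

definition color :: "nat \<Rightarrow> pos" where
  "color k = pos_of_nat (Suc k)"

lemma color_less_iff [simp]: "color a < color b \<longleftrightarrow> a < b"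
  by (simp add: color_def less_pos.rep_eq pos_of_nat_inverse)

lemma color_le_iff [simp]: "color a \<le> color b \<longleftrightarrow> a \<le> b"
  by (simp add: color_def less_eq_pos.rep_eq pos_of_nat_inverse)

lemma color_eq_iff [simp]: "color a = color b \<longleftrightarrow> a = b"
  by (simp add: order.eq_iff)

lemma obtain_color:
  obtains k where "j = color k"
proof
  have "Suc (nat_of_pos j - 1) = nat_of_pos j" using nat_of_pos[of j] by simp
  then show "j = color (nat_of_pos j - 1)" by (simp add: color_def nat_of_pos_inverse)
qed

lemma finite_color_count:
  assumes "finite V" "\<kappa> \<in> proper_colorings V E"
  shows "finite {j. color_count V \<kappa> j \<noteq> 0}"
proof (rule finite_subset)
  show "{j. color_count V \<kappa> j \<noteq> 0} \<subseteq> (\<Union>v\<in>V. \<kappa> v)"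
  proof
    fix j assume "j \<in> {j. color_count V \<kappa> j \<noteq> 0}"
    then have "card {v \<in> V. j \<in> \<kappa> v} \<noteq> 0" by (simp only: color_count_def mem_Collect_eq not_False_eq_True)
    then have "{v \<in> V. j \<in> \<kappa> v} \<noteq> {}" by (rule contrapos_nn) (simp only: card.empty)
    then show "j \<in> (\<Union>v\<in>V. \<kappa> v)" by blast
  qed
  show "finite (\<Union>v\<in>V. \<kappa> v)" using proper_colorings_mem[OF assms(2)] by (intro finite_UN_I assms(1)) auto
qed

lemma color_count_pos: "finite V \<Longrightarrow> v \<in> V \<Longrightarrow> j \<in> \<kappa> v \<Longrightarrow> color_count V \<kappa> j \<noteq> 0"
  by (auto simp: color_count_def)

text \<open>Double counting of the pairs of a vertex and one of its colors in \<open>J\<close>.\<close>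

lemma sum_card_inter_eq:
  assumes "finite V" "finite J"
  shows "(\<Sum>v\<in>V. card (\<kappa> v \<inter> J)) = (\<Sum>j\<in>J. color_count V \<kappa> j)"
proof -
  have "card (\<kappa> v \<inter> J) = card {j \<in> J. j \<in> \<kappa> v}" for v
    by (rule arg_cong[where f = card]) blast
  then show ?thesis
    using sum_multicount_gen[OF assms, of "\<lambda>v j. j \<in> \<kappa> v" "color_count V \<kappa>"]
    by (simp add: color_count_def)
qed

text \<open>Only exponents that some coloring realizes occur here; this spares the detour through
finitely supported monomials.\<close>

definition symmetric_counts :: "'v set \<Rightarrow> 'v set set \<Rightarrow> ('v \<times> 'v) set \<Rightarrow> bool" where
  "symmetric_counts V E r \<longleftrightarrow> (\<forall>\<kappa>\<in>proper_colorings V E. \<forall>i \<sigma>. bij \<sigma> \<longrightarrow>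
     card (colorings_with V E r i (color_count V \<kappa> \<circ> \<sigma>)) =
     card (colorings_with V E r i (color_count V \<kappa>)))"

context ord_graph
begin

lemma proper_coloringsI:
  assumes "\<kappa> \<in> extensional V" "\<And>v. v \<in> V \<Longrightarrow> finite (\<kappa> v) \<and> \<kappa> v \<noteq> {}"
    and "\<And>u v. u \<in> V \<Longrightarrow> v \<in> V \<Longrightarrow> {u, v} \<in> E \<Longrightarrow> \<kappa> u \<inter> \<kappa> v = {}"
  shows "\<kappa> \<in> proper_colorings V E"
  using assms edgeD unfolding proper_colorings_def PiE_def by blast

text \<open>The extra color 0 on the vertices of \<open>S\<close> does not affect the maxima. After it is exchanged with an unused
color above all others, the vertices that carry it attain the overall maximum,
so no arc can start there.\<close>

lemma stable_le_sinks:
  assumes sym: "symmetric_counts V E r" and S: "S \<subseteq> V" "stable_set E S"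
  shows "card S \<le> card L"
proof -
  define \<kappa> where "\<kappa> = (\<lambda>u\<in>V. insert (color (Suc (\<rho> u))) (if u \<in> S then {color 0} else {}))"
  have proper: "\<kappa> \<in> proper_colorings V E"
  proof (rule proper_coloringsI)
    fix u v assume uv: "u \<in> V" "v \<in> V" "{u, v} \<in> E"
    then have "\<rho> u \<noteq> \<rho> v" using edgeD inj_on_vertex_rank by (auto dest: inj_onD)
    moreover have "u \<notin> S \<or> v \<notin> S" using S uv by (auto simp: stable_set_def)
    ultimately show "\<kappa> u \<inter> \<kappa> v = {}" using uv by (auto simp: \<kappa>_def)
  qed (auto simp: \<kappa>_def)
  have Max: "Max (\<kappa> u) = color (Suc (\<rho> u))" if "u \<in> V" for u
    using that by (intro Max_eqI) (auto simp: \<kappa>_def split: if_splits)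
  have "asc E r (Max \<circ> \<kappa>) = card E"
    unfolding asc_eq_card_iff using Max arcD vertex_rank_arc by auto
  then have mem: "\<kappa> \<in> colorings_with V E r (card E) (color_count V \<kappa>)"
    using proper by (simp add: colorings_with_def)
  have large: "color_count V \<kappa> (color k) = 0" if "n < k" for k
  proof -
    have "color k \<notin> \<kappa> v" if "v \<in> V" for v
      using that \<open>n < k\<close> vertex_rank_lt[OF that] by (auto simp: \<kappa>_def)
    then have "{v \<in> V. color k \<in> \<kappa> v} = {}" by blast
    then show ?thesis by (simp only: color_count_def card.empty)
  qed
  have "{v \<in> V. color 0 \<in> \<kappa> v} = S" using S by (auto simp: \<kappa>_def split: if_splits)
  then have zero: "color_count V \<kappa> (color 0) = card S" by (simp add: color_count_def)
  let ?\<sigma> = "transpose (color 0) (color (Suc n))"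
  have "card (colorings_with V E r (card E) (color_count V \<kappa> \<circ> ?\<sigma>)) =
      card (colorings_with V E r (card E) (color_count V \<kappa>))"
    using sym proper by (simp add: symmetric_counts_def)
  moreover have "card (colorings_with V E r (card E) (color_count V \<kappa>)) > 0"
    using finite_colorings_with[OF fin finite_color_count[OF fin proper]] mem
    by (auto simp: card_gt_0_iff)
  ultimately obtain \<kappa>' where "\<kappa>' \<in> colorings_with V E r (card E) (color_count V \<kappa> \<circ> ?\<sigma>)"
    by (metis card_gt_0_iff ex_in_conv)
  then have \<kappa>': "\<kappa>' \<in> proper_colorings V E" "asc E r (Max \<circ> \<kappa>') = card E"
    "\<And>j. color_count V \<kappa>' j = color_count V \<kappa> (?\<sigma> j)"
    by (auto simp: colorings_with_def)
  have top: "j \<le> color (Suc n)" if "v \<in> V" "j \<in> \<kappa>' v" for v j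
  proof (rule ccontr)
    assume j: "\<not> j \<le> color (Suc n)"
    obtain k where k: "j = color k" by (rule obtain_color)
    then have "?\<sigma> j = color k" "n < k" using j by (auto simp: transpose_def)
    then show False using large[of k] color_count_pos[of V v j \<kappa>'] fin that \<kappa>'(3)[of j] by simp
  qed
  have "{v \<in> V. color (Suc n) \<in> \<kappa>' v} \<subseteq> L"
  proof
    fix v assume v: "v \<in> {v \<in> V. color (Suc n) \<in> \<kappa>' v}"
    have "\<not> arc E r v w" for w
    proof
      assume "arc E r v w"
      then have w: "w \<in> V" "Max (\<kappa>' v) < Max (\<kappa>' w)"
        using \<kappa>'(2) arcD[of v w] unfolding asc_eq_card_iff by auto
      have "color (Suc n) \<le> Max (\<kappa>' v)"
        using v proper_colorings_mem[OF \<kappa>'(1)] by (intro Max_ge) auto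
      moreover have "Max (\<kappa>' w) \<le> color (Suc n)"
        using top[OF w(1)] proper_colorings_mem[OF \<kappa>'(1) w(1)] by (intro Max.boundedI) auto
      ultimately show False using w(2) by simp
    qed
    then show "v \<in> L" using v by (simp add: sinks_def)
  qed
  then have "card {v \<in> V. color (Suc n) \<in> \<kappa>' v} \<le> card L"
    using fin by (intro card_mono) (auto simp: sinks_def)
  then show ?thesis using \<kappa>'(3)[of "color (Suc n)"] zero by (simp add: color_count_def)
qed

end

text \<open>\<open>base\<close> is the coloring that will have no counterpart: singletons, low colors off \<open>C\<close> and high colors
(from \<open>n\<close> on) inside \<open>C\<close>, where all sinks share the topmost color. The transposition \<open>\<sigma>\<close> moves the
multiplicity of the topmost color, at least 2, to the lowest high color, that of the root.\<close>

locale rooted_minimal_up_closed = minimal_up_closed V E r C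
  for V :: "'v set" and E and r and C +
  fixes root :: 'v
  assumes root: "source root"
begin

definition height :: "'v \<Rightarrow> nat" where
  "height u = (if u \<in> L \<inter> C then 2 * n else if u \<in> C then n + \<rho> u else \<rho> u)"

definition base :: "'v \<Rightarrow> pos set" where
  "base = (\<lambda>u\<in>V. {color (height u)})"

abbreviation "low \<equiv> color (height root)"
abbreviation "peak \<equiv> color (2 * n)"
abbreviation "\<sigma> \<equiv> transpose low peak"
abbreviation "d \<equiv> color_count V base"

definition high :: "('v \<Rightarrow> pos set) \<Rightarrow> 'v set" where
  "high \<kappa> = {u \<in> V. color n \<le> Max (\<kappa> u)}"

lemma rootC: "root \<in> C" and rootV: "root \<in> V"
  using root CV by (auto simp: source_def)

lemma height_root: "height root = n + \<rho> root"
  using source_not_sink[OF root] rootC by (simp add: height_def)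

lemma height_arc: "arc E r u v \<Longrightarrow> height u < height v"
  using arc_up[of u v] arcD[of u v] vertex_rank_arc[of u v] vertex_rank_lt[of u] vertex_rank_lt[of v]
  unfolding height_def sinks_def by auto

lemma height_ge_iff: "u \<in> V \<Longrightarrow> n \<le> height u \<longleftrightarrow> u \<in> C"
  using vertex_rank_lt[of u] by (auto simp: height_def)

lemma height_le: "u \<in> V \<Longrightarrow> height u \<le> 2 * n"
  using vertex_rank_lt[of u] by (auto simp: height_def)

lemma base_proper: "base \<in> proper_colorings V E"
proof (rule proper_coloringsI)
  fix u v assume uv: "u \<in> V" "v \<in> V" "{u, v} \<in> E"
  then have "height u \<noteq> height v" using edge_arc[of u v] height_arc[of u v] height_arc[of v u] by auto
  then show "base u \<inter> base v = {}" using uv by (simp add: base_def)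
qed (auto simp: base_def)

lemma base_mem: "base \<in> colorings_with V E r (card E) d"
  using base_proper height_arc arcD unfolding colorings_with_def
  by (auto simp: asc_eq_card_iff base_def)

lemma high_base: "high base = C"
  using CV height_ge_iff by (auto simp: high_def base_def)

lemma d_color: "d (color k) = card {u \<in> V. height u = k}"
proof -
  have "{v \<in> V. color k \<in> base v} = {u \<in> V. height u = k}" by (auto simp: base_def)
  then show ?thesis by (simp add: color_count_def)
qed

lemma d_peak: "d peak = card (L \<inter> C)"
proof -
  have "{u \<in> V. height u = 2 * n} = L \<inter> C"
  proof (intro set_eqI)
    fix u show "u \<in> {u \<in> V. height u = 2 * n} \<longleftrightarrow> u \<in> L \<inter> C"
      using CV vertex_rank_lt[of u] by (auto simp: height_def)
  qed
  then show ?thesis by (simp add: d_color)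
qed

text \<open>Both exchanged colors are high, so \<open>\<sigma>\<close> respects the division into low and high colors.\<close>

lemma \<sigma>_ge_iff: "color n \<le> \<sigma> j \<longleftrightarrow> color n \<le> j"
  using height_root by (cases "j = low"; cases "j = peak") auto

lemma sum_d_\<sigma>:
  assumes "m \<le> n"
  shows "(\<Sum>j\<in>color ` {m..2 * n}. d (\<sigma> j)) = (\<Sum>j\<in>color ` {m..2 * n}. d j)"
proof -
  have "low \<in> color ` {m..2 * n}" "peak \<in> color ` {m..2 * n}"
    using assms height_root height_le[OF rootV] by auto
  then have "bij_betw \<sigma> (color ` {m..2 * n}) (color ` {m..2 * n})" by simp
  then show ?thesis by (rule sum.reindex_bij_betw)
qed

text \<open>The root is the lowest vertex of \<open>C\<close>, so no color between \<open>n\<close> and the color of the root is used.\<close>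

lemma no_d_between:
  assumes "n \<le> k" "k < height root"
  shows "d (color k) = 0"
proof -
  have "height u \<noteq> k" if u: "u \<in> V" for u
  proof
    assume k: "height u = k"
    then have "u \<in> C" using height_ge_iff[OF u] assms by simp
    moreover from this have "u \<noteq> root" using k assms by auto
    ultimately have "\<rho> root < \<rho> u" using vertex_rank_arc by (intro source_least[OF root])
    then show False
      using k assms height_root vertex_rank_lt[OF rootV] \<open>u \<in> C\<close> by (auto simp: height_def split: if_splits)
  qed
  then have "{u \<in> V. height u = k} = {}" by blast
  then show ?thesis by (simp only: d_color card.empty)
qed

context
  fixes \<kappa> :: "'v \<Rightarrow> pos set"
  assumes \<kappa>: "\<kappa> \<in> colorings_with V E r (card E) (d \<circ> \<sigma>)"
begin

lemma \<kappa>_proper: "\<kappa> \<in> proper_colorings V E"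
  and \<kappa>_arc: "arc E r u v \<Longrightarrow> Max (\<kappa> u) < Max (\<kappa> v)"
  and \<kappa>_count: "color_count V \<kappa> j = d (\<sigma> j)"
  using \<kappa> by (auto simp: colorings_with_def asc_eq_card_iff)

lemma \<kappa>_colors:
  assumes "v \<in> V"
  shows "\<kappa> v \<subseteq> color ` {0..2 * n}"
proof
  fix j assume "j \<in> \<kappa> v"
  then have "d (\<sigma> j) \<noteq> 0"
    using color_count_pos[OF fin assms] \<kappa>_count by metis
  obtain k where k: "\<sigma> j = color k" by (rule obtain_color)
  then have "{u \<in> V. height u = k} \<noteq> {}" using \<open>d (\<sigma> j) \<noteq> 0\<close> d_color by (metis card.empty)
  then have "k \<le> 2 * n" using height_le by blast
  have "j = \<sigma> (color k)" using k by (metis transpose_involutory)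
  then show "j \<in> color ` {0..2 * n}"
    using \<open>k \<le> 2 * n\<close> height_le[OF rootV] by (auto simp: transpose_def)
qed

text \<open>The total number of occurrences of colors is the same for \<open>\<kappa>\<close> and \<open>base\<close>, namely \<open>n\<close>, which leaves exactly
one color for each vertex.\<close>

lemma \<kappa>_single:
  assumes "v \<in> V"
  shows "\<kappa> v = {Max (\<kappa> v)}"
proof -
  let ?J = "color ` {0..2 * n}"
  have "(\<Sum>v\<in>V. card (\<kappa> v)) = (\<Sum>v\<in>V. card (\<kappa> v \<inter> ?J))"
    using \<kappa>_colors by (intro sum.cong refl) (simp add: Int_absorb2)
  also have "\<dots> = (\<Sum>j\<in>?J. d j)"
    using sum_d_\<sigma>[of 0] sum_card_inter_eq[OF fin, of ?J] by (simp add: \<kappa>_count)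
  also have "\<dots> = (\<Sum>v\<in>V. card (base v \<inter> ?J))"
    using sum_card_inter_eq[OF fin, of ?J] by simp
  also have "\<dots> = (\<Sum>v\<in>V. 1)"
  proof (intro sum.cong refl)
    fix v assume "v \<in> V"
    then have "base v \<inter> ?J = {color (height v)}" using height_le by (auto simp: base_def)
    then show "card (base v \<inter> ?J) = 1" by simp
  qed
  finally have total: "(\<Sum>v\<in>V. card (\<kappa> v)) = (\<Sum>v\<in>V. 1)" .
  have ge: "1 \<le> card (\<kappa> v)" if "v \<in> V" for v
    using proper_colorings_mem[OF \<kappa>_proper that] by (simp add: Suc_le_eq card_gt_0_iff)
  have "card (\<kappa> v) = 1"
  proof (rule ccontr)
    assume "card (\<kappa> v) \<noteq> 1"
    then have "1 < card (\<kappa> v)" using ge[OF assms] by simp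
    then have "(\<Sum>v\<in>V. 1) < (\<Sum>v\<in>V. card (\<kappa> v))"
      using fin ge assms by (intro sum_strict_mono_ex1) auto
    then show False using total by simp
  qed
  then obtain j where "\<kappa> v = {j}" by (rule card_1_singletonE)
  then show ?thesis by simp
qed

lemma high_up_closed: "up_closed V E r (high \<kappa>)"
  using \<kappa>_arc arcD by (fastforce simp: up_closed_def high_def)

text \<open>The exponents of the high colors have the same sum for \<open>\<kappa>\<close> and \<open>base\<close>, and color sets are singletons.\<close>

lemma card_high: "card (high \<kappa>) = card C"
proof -
  let ?J = "color ` {n..2 * n}"
  have card_eq: "(\<Sum>v\<in>V. card (\<mu> v \<inter> ?J)) = card (high \<mu>)"
    if single: "\<And>v. v \<in> V \<Longrightarrow> \<mu> v = {Max (\<mu> v)} \<and> Max (\<mu> v) \<le> peak" for \<mu> :: "'v \<Rightarrow> pos set"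
  proof -
    have "card (\<mu> v \<inter> ?J) = (if v \<in> high \<mu> then 1 else 0)" if v: "v \<in> V" for v
    proof -
      obtain k where k: "Max (\<mu> v) = color k" by (rule obtain_color)
      then have "\<mu> v = {color k}" "k \<le> 2 * n" using single[OF v] by auto
      then show ?thesis using v by (auto simp: high_def)
    qed
    then have "(\<Sum>v\<in>V. card (\<mu> v \<inter> ?J)) = (\<Sum>v\<in>V. if v \<in> high \<mu> then 1 else 0)" by simp
    also have "\<dots> = card (high \<mu>)" using fin by (simp add: sum.If_cases high_def Int_def)
    finally show ?thesis .
  qed
  have "card (high \<kappa>) = (\<Sum>v\<in>V. card (\<kappa> v \<inter> ?J))"
  proof (rule card_eq[symmetric])
    fix v assume v: "v \<in> V"
    have "Max (\<kappa> v) \<in> \<kappa> v" using proper_colorings_mem[OF \<kappa>_proper v] by (auto intro: Max_in)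
    then have "Max (\<kappa> v) \<le> peak" using \<kappa>_colors[OF v] by auto
    then show "\<kappa> v = {Max (\<kappa> v)} \<and> Max (\<kappa> v) \<le> peak" using \<kappa>_single[OF v] by simp
  qed
  also have "\<dots> = (\<Sum>j\<in>?J. d j)"
    using sum_d_\<sigma>[of n] sum_card_inter_eq[OF fin, of ?J] by (simp add: \<kappa>_count)
  also have "\<dots> = (\<Sum>v\<in>V. card (base v \<inter> ?J))"
    using sum_card_inter_eq[OF fin, of ?J] by simp
  also have "\<dots> = card (high base)"
    using height_le by (intro card_eq) (auto simp: base_def)
  finally show ?thesis by (simp add: high_base)
qed

text \<open>Otherwise \<open>high \<kappa>\<close> would itself be a smallest obstruction, so just one vertex would have the least maximum in
it. But the color \<open>low\<close> is the least high color that occurs in \<open>\<kappa>\<close>, and it occurs at least twice.\<close>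

lemma high_free: "P3_free E (high \<kappa>)"
proof (rule ccontr)
  assume not_free': "\<not> P3_free E (high \<kappa>)"
  interpret H: minimal_up_closed V E r "high \<kappa>"
    using max high_up_closed not_free' minimal card_high by unfold_locales auto
  obtain s where s: "H.source s" by (rule H.obtain_source)
  then have "s \<in> high \<kappa>" by (simp add: H.source_def)
  then have sV: "s \<in> V" "color n \<le> Max (\<kappa> s)" by (simp_all add: high_def)
  \<comment> \<open>the multiplicity of the topmost color of base, moved to low\<close>
  have "2 \<le> card {v \<in> V. low \<in> \<kappa> v}"
    using \<kappa>_count[of low] d_peak two_le_card_sinks by (simp add: color_count_def)
  then have "\<not> {v \<in> V. low \<in> \<kappa> v} \<subseteq> {s}"
    using card_mono[of "{s}" "{v \<in> V. low \<in> \<kappa> v}"] by auto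
  then obtain v where v: "v \<in> V" "low \<in> \<kappa> v" "v \<noteq> s" by blast
  then have "Max (\<kappa> v) = low" using \<kappa>_single[OF v(1)] by (metis singletonD)
  moreover from this have "v \<in> high \<kappa>" using v height_root by (simp add: high_def)
  ultimately have less: "Max (\<kappa> s) < low"
    using H.source_least[OF s, of "\<lambda>v. Max (\<kappa> v)" v] \<kappa>_arc v by simp
  obtain k where k: "Max (\<kappa> s) = color k" by (rule obtain_color)
  then have "n \<le> k" "k < height root" using sV less by auto
  moreover from this have "\<sigma> (color k) = color k"
    using height_le[OF rootV] by (intro transpose_apply_other) auto
  moreover have "color k \<in> \<kappa> s" using \<kappa>_single[OF sV(1)] k by simp
  ultimately show False
    using no_d_between[of k] color_count_pos[OF fin sV(1)] \<kappa>_count[of "color k"] by metis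
qed

text \<open>Renaming by \<open>\<sigma>\<close> on the high part keeps high and low vertices apart. Hence edges
between the two parts remain proper and ascending, and low vertices keep their colors.\<close>

lemma rename_high:
  shows "rename V E (high \<kappa>) \<sigma> \<kappa> \<in> colorings_with V E r (card E) d"
    and "high (rename V E (high \<kappa>) \<sigma> \<kappa>) = high \<kappa>"
    and "\<kappa> \<in> set_maps V E (high \<kappa>)"
proof -
  let ?H = "high \<kappa>" and ?\<kappa> = "rename V E (high \<kappa>) \<sigma> \<kappa>"
  have HV: "?H \<subseteq> V" by (auto simp: high_def)
  show maps: "\<kappa> \<in> set_maps V E ?H"
    using \<kappa>_proper unfolding set_maps_def proper_colorings_def by blast
  interpret clique_coloring V E ?H \<kappa>
    using fin HV high_free maps by unfold_locales
  have inj: "inj \<sigma>" by (simp add: bij_is_inj)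
  have outside: "?\<kappa> v = \<kappa> v" if v: "v \<in> V" "v \<notin> ?H" for v
  proof -
    have "Max (\<kappa> v) < color n" using v by (simp add: high_def)
    then have "Max (\<kappa> v) \<noteq> low" "Max (\<kappa> v) \<noteq> peak" using height_root by auto
    then have "\<sigma> (Max (\<kappa> v)) = Max (\<kappa> v)" by simp
    then have "\<sigma> ` \<kappa> v = \<kappa> v" using \<kappa>_single[OF v(1)] by (metis image_empty image_insert)
    then show ?thesis using rename_outside[OF v inj] by simp
  qed
  have inside: "\<exists>j. ?\<kappa> v = {j} \<and> color n \<le> j" if v: "v \<in> ?H" for v
  proof -
    obtain w where w: "w \<in> ?H" "?\<kappa> v = \<sigma> ` \<kappa> w" using rename_inside[OF v inj] by blast
    then have "\<kappa> w = {Max (\<kappa> w)}" "color n \<le> Max (\<kappa> w)" using \<kappa>_single[of w] by (auto simp: high_def)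
    then have "?\<kappa> v = {\<sigma> (Max (\<kappa> w))}" "color n \<le> \<sigma> (Max (\<kappa> w))"
      using w(2) \<sigma>_ge_iff by (metis image_empty image_insert, blast)
    then show ?thesis by blast
  qed
  have Max_ge: "color n \<le> Max (?\<kappa> v) \<longleftrightarrow> v \<in> ?H" if v: "v \<in> V" for v
    using inside[of v] outside[of v] v by (cases "v \<in> ?H") (auto simp: high_def)
  then show "high ?\<kappa> = ?H" using HV by (auto simp: high_def)
  have maps': "?\<kappa> \<in> set_maps V E ?H" by (rule rename_mem_set_maps[OF inj])
  have cross: "?\<kappa> u \<inter> ?\<kappa> w = {}" if "u \<in> ?H" "w \<in> V" "w \<notin> ?H" for u w
  proof -
    obtain j where "?\<kappa> u = {j}" "color n \<le> j" using inside[OF \<open>u \<in> ?H\<close>] by blast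
    moreover have "?\<kappa> w = {Max (\<kappa> w)}" "Max (\<kappa> w) < color n"
      using outside \<kappa>_single[of w] that by (auto simp: high_def)
    ultimately show ?thesis by auto
  qed
  have proper: "?\<kappa> \<in> proper_colorings V E"
  proof (rule proper_coloringsI)
    show "?\<kappa> \<in> extensional V" by (simp add: rename_def)
    show "finite (?\<kappa> v) \<and> ?\<kappa> v \<noteq> {}" if "v \<in> V" for v
      using maps' that by (auto simp: set_maps_def dest: PiE_mem)
    fix u w assume uw: "u \<in> V" "w \<in> V" "{u, w} \<in> E"
    consider "u \<in> ?H" "w \<in> ?H" | "u \<in> ?H" "w \<notin> ?H" | "u \<notin> ?H" "w \<in> ?H" | "u \<notin> ?H" "w \<notin> ?H"
      by blast
    then show "?\<kappa> u \<inter> ?\<kappa> w = {}"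
    proof cases
      case 1
      then show ?thesis using maps' uw by (auto simp: set_maps_def)
    next
      case 2
      then show ?thesis using cross uw by blast
    next
      case 3
      then show ?thesis using cross uw by blast
    next
      case 4
      then show ?thesis
        using outside uw \<kappa>_proper by (simp add: proper_colorings_def)
    qed
  qed
  have "Max (?\<kappa> u) < Max (?\<kappa> w)" if a: "arc E r u w" for u w
  proof -
    have uw: "u \<in> V" "w \<in> V" "{u, w} \<in> E" using arcD[OF a] by auto
    consider "u \<in> ?H" "w \<in> ?H" | "u \<notin> ?H" "w \<in> ?H" | "u \<notin> ?H" "w \<notin> ?H"
      using high_up_closed a unfolding up_closed_def by blast
    then show ?thesis
    proof cases
      case 1
      then have "w \<in> clique_of E ?H u" using uw by (simp add: clique_of_def)
      then show ?thesis using Max_rename_less_iff[OF inj uw(1)] \<kappa>_arc[OF a] by blast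
    next
      case 2
      then show ?thesis using Max_ge[OF uw(1)] Max_ge[OF uw(2)] by (meson less_le_trans not_le)
    next
      case 3
      then show ?thesis using outside uw \<kappa>_arc[OF a] by simp
    qed
  qed
  then have "asc E r (Max \<circ> ?\<kappa>) = card E" by (simp add: asc_eq_card_iff)
  moreover have "color_count V ?\<kappa> j = d j" for j
  proof -
    have "color_count V ?\<kappa> j = color_count V \<kappa> (\<sigma> j)"
      using card_rename[of \<sigma> "\<sigma> j"] by (simp add: color_count_def)
    then show ?thesis by (simp add: \<kappa>_count)
  qed
  ultimately show "?\<kappa> \<in> colorings_with V E r (card E) d"
    using proper by (auto simp: colorings_with_def)
qed

end

text \<open>The high part of a coloring can be read off from its image, so renaming is injective; \<open>base\<close> is
missed because its high part is not \<open>P3_free\<close>.\<close>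

lemma card_colorings_with_less:
  "card (colorings_with V E r (card E) (d \<circ> \<sigma>)) < card (colorings_with V E r (card E) d)"
proof -
  let ?A = "colorings_with V E r (card E) d" and ?B = "colorings_with V E r (card E) (d \<circ> \<sigma>)"
  let ?T = "\<lambda>\<kappa>. rename V E (high \<kappa>) \<sigma> \<kappa>"
  have finA: "finite ?A"
    by (rule finite_colorings_with[OF fin finite_color_count[OF fin base_proper]])
  have "inj_on ?T ?B"
  proof (rule inj_onI)
    fix \<kappa> \<kappa>' assume k: "\<kappa> \<in> ?B" "\<kappa>' \<in> ?B" and eq: "?T \<kappa> = ?T \<kappa>'"
    have "high \<kappa> = high \<kappa>'" using rename_high(2)[OF k(1)] rename_high(2)[OF k(2)] eq by simp
    moreover have "rename V E (high \<kappa>) (inv \<sigma>) (?T \<kappa>) = \<kappa>"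
      using fin high_free[OF k(1)] rename_high(3)[OF k(1)]
      by (intro rename_inverse) (auto simp: high_def)
    moreover have "rename V E (high \<kappa>') (inv \<sigma>) (?T \<kappa>') = \<kappa>'"
      using fin high_free[OF k(2)] rename_high(3)[OF k(2)]
      by (intro rename_inverse) (auto simp: high_def)
    ultimately show "\<kappa> = \<kappa>'" using eq by metis
  qed
  then have "card ?B = card (?T ` ?B)" by (simp add: card_image)
  also have "\<dots> \<le> card (?A - {base})"
  proof (rule card_mono)
    show "?T ` ?B \<subseteq> ?A - {base}"
    proof
      fix x assume "x \<in> ?T ` ?B"
      then obtain \<kappa> where k: "\<kappa> \<in> ?B" "x = ?T \<kappa>" by blast
      then have "high x \<noteq> high base"
        using rename_high(2)[OF k(1)] high_free[OF k(1)] not_free high_base by metis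
      then show "x \<in> ?A - {base}" using rename_high(1)[OF k(1)] k(2) by blast
    qed
  qed (use finA in simp)
  also have "\<dots> < card ?A" using finA base_mem by (intro card_Diff1_less)
  finally show ?thesis .
qed

end

lemma (in ord_graph) symmetric_counts_imp_P3_free:
  assumes sym: "symmetric_counts V E r"
  shows "P3_free E V"
proof (rule ccontr)
  assume "\<not> P3_free E V"
  moreover have "up_closed V E r V" using arcD by (auto simp: up_closed_def)
  ultimately have V: "up_closed V E r V \<and> \<not> P3_free E V" by blast
  define C where "C = arg_min card (\<lambda>C. up_closed V E r C \<and> \<not> P3_free E C)"
  have C: "up_closed V E r C" "\<not> P3_free E C"
    using arg_min_natI[of "\<lambda>C. up_closed V E r C \<and> \<not> P3_free E C" V card, OF V] by (auto simp: C_def)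
  have minimal: "P3_free E D" if "up_closed V E r D" "card D < card C" for D
    using that arg_min_nat_le[of "\<lambda>C. up_closed V E r C \<and> \<not> P3_free E C" D card]
    unfolding C_def by (meson not_le)
  interpret minimal_up_closed V E r C
    using stable_le_sinks[OF sym] C minimal by unfold_locales
  obtain s where "source s" by (rule obtain_source)
  then interpret rooted_minimal_up_closed V E r C s by unfold_locales
  show False
    using card_colorings_with_less sym base_proper by (simp add: symmetric_counts_def)
qed

theorem theorem4p8:
  fixes V :: "'v set" and E :: "'v set set" and r :: "('v \<times> 'v) set"
  assumes "ordered_graph V E r"
  shows "(Lbar V E r :: 'k::{idom, ring_char_0} mps poly) \<in> mSym_q \<longleftrightarrow> cluster_graph V E"
proof -
  interpret ord_graph V E r by unfold_locales (rule assms)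
  have "(Lbar V E r :: 'k mps poly) \<in> mSym_q \<longleftrightarrow> P3_free E V"
  proof
    assume "(Lbar V E r :: 'k mps poly) \<in> mSym_q"
    then have "card (colorings_with V E r i (Poly_Mapping.lookup m \<circ> \<sigma>)) =
        card (colorings_with V E r i (Poly_Mapping.lookup m))" if "bij \<sigma>" for i \<sigma> m
      using that Lbar_symmetric_iff[OF assms] by blast
    then have "symmetric_counts V E r"
      unfolding symmetric_counts_def using lookup_coloring_monomial[OF fin] by metis
    then show "P3_free E V" by (rule symmetric_counts_imp_P3_free)
  next
    assume free: "P3_free E V"
    have "finite {j. Poly_Mapping.lookup m j \<noteq> 0}" for m :: mon
      using finite_keys[of m] by (simp add: Poly_Mapping.keys.rep_eq)
    then show "(Lbar V E r :: 'k mps poly) \<in> mSym_q"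
      unfolding Lbar_symmetric_iff[OF assms]
      using cluster_graph_card_colorings_with[OF assms free] by blast
  qed
  then show ?thesis using cluster_graph_iff_P3_free[OF edges] by simp
qed

end
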